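(* Let $(\mathbf u,\mathbf W)$ be a minimizer for $J$ in $\mathcal F(\Omega)$, suppose that $u_1$ is continuous, that $f_1$ and $g_1$ are bounded, and that there are $\lambda>0$ and $\varepsilon>0$ such that the following nondegeneracy condition holds: for each measurable set $A\subset W_1$ with $0<|A|\le\varepsilon$, there are disjoint subsets $A_j\subset A$, $2\le j\le N$, such that $$F(W_1\setminus A,W_2\cup A_2,\dots,W_N\cup A_N)\le F(\mathbf W)-\lambda|A|.$$ Set $\Omega_1=\{x\in\Omega: u_1(x)>0\}$ and $\delta(x)=\operatorname{dist}(x,\mathbb R^n\setminus\Omega_1)$. For each $C_0\ge1$, there is a constant $c_5>0$, that depends only on $n$, $\lambda$, $\|f_1\|_\infty$, $\|g_1\|_\infty$, and $C_0$, such that $$u_1(x)\ge c_5\min(\delta(x),\varepsilon^{1/n},1)$$ as soon as $x\in\Omega_1$ and $u_1$ is $C_0$-Lipschitz on $B(x,\delta(x)/2)$.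
   Context: $n\ge2$ and $N\ge1$ are integers; $|A|$ is the Lebesgue measure of $A$; $B(x,r)$ is the open ball; $\Omega\subset\mathbb R^n$ is a Borel set with $|\Omega|<+\infty$. $W^{1,2}(\mathbb R^n)$ denotes the set of functions in $L^2_{loc}(\mathbb R^n)$ whose distributional gradient lies in $L^2(\mathbb R^n)$. $\mathcal W(\Omega)$ is the set of $N$-tuples $\mathbf W=(W_1,\dots,W_N)$ of pairwise disjoint Borel subsets of $\Omega$. $\mathcal F(\Omega)$ is the set of pairs $(\mathbf u,\mathbf W)$ with $\mathbf W\in\mathcal W(\Omega)$ and $\mathbf u=(u_1,\dots,u_N)$ an $N$-tuple of real-valued functions $u_i\in W^{1,2}(\mathbb R^n)$ such that $u_i(x)=0$ for almost every $x\in\mathbb R^n\setminus W_i$. Given measurable functions $f_i,g_i$ on $\Omega$ (such that the integrals below converge) and $F:\mathcal W(\Omega)\to\mathbb R$, $$J(\mathbf u,\mathbf W)=\sum_{i=1}^N\int|\nabla u_i|^2\,dx+\sum_{i=1}^N\int[u_i^2f_i-u_ig_i]\,dx+F(W_1,\dots,W_N).$$ A minimizer for $J$ in $\mathcal F(\Omega)$ is a pair $(\mathbf u,\mathbf W)\in\mathcal F(\Omega)$ such that $J(\mathbf u,\mathbf W)\le J(\mathbf u^*,\mathbf W^* )$ for all $(\mathbf u^*,\mathbf W^* )\in\mathcal F(\Omega)$. *)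

theory Defs
  imports "HOL-Analysis.Analysis" "HOL-Probability.Essential_Supremum"
begin

primrec cont_diff :: "nat \<Rightarrow> (real^'n \<Rightarrow> real) \<Rightarrow> bool" where
  "cont_diff 0 f \<longleftrightarrow> continuous_on UNIV f"
| "cont_diff (Suc k) f \<longleftrightarrow>
     (\<forall>x. f differentiable (at x)) \<and>
     (\<forall>v. cont_diff k (\<lambda>x. frechet_derivative f (at x) v))"

definition test_function :: "(real^'n \<Rightarrow> real) \<Rightarrow> bool" where
  "test_function \<phi> \<longleftrightarrow> (\<forall>k. cont_diff k \<phi>) \<and> compact (closure {x. \<phi> x \<noteq> 0})"

definition L2_loc :: "(real^'n \<Rightarrow> real) set" where
  "L2_loc = {u \<in> borel_measurable lebesgue.
     \<forall>K. compact K \<longrightarrow> integrable (lebesgue_on K) (\<lambda>x. (u x)\<^sup>2)}"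

definition L2_fields :: "(real^'n \<Rightarrow> real^'n) set" where
  "L2_fields = {G \<in> borel_measurable lebesgue. integrable lebesgue (\<lambda>x. (norm (G x))\<^sup>2)}"

definition has_distr_gradient :: "(real^'n \<Rightarrow> real) \<Rightarrow> (real^'n \<Rightarrow> real^'n) \<Rightarrow> bool" where
  "has_distr_gradient u G \<longleftrightarrow>
     (\<forall>\<phi> i. test_function \<phi> \<longrightarrow>
        (LINT x|lebesgue. u x * frechet_derivative \<phi> (at x) (axis i 1))
          = - (LINT x|lebesgue. (G x $ i) * \<phi> x))"

definition W12 :: "(real^'n \<Rightarrow> real) set" where
  "W12 = {u \<in> L2_loc. \<exists>G \<in> L2_fields. has_distr_gradient u G}"

text \<open>For a function in \<^const>\<open>W12\<close> the distributional gradient is unique up to null sets, so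
  integrals involving it do not depend on the representative chosen here.\<close>

definition distr_gradient :: "(real^'n \<Rightarrow> real) \<Rightarrow> real^'n \<Rightarrow> real^'n" where
  "distr_gradient u = (SOME G. G \<in> L2_fields \<and> has_distr_gradient u G)"

text \<open>\<open>N\<close>-tuples are extensional functions on \<open>{1..N}\<close>, so that a function of \<open>N\<close>-tuples cannot
  depend on values at other indices.\<close>

definition admissible_sets :: "nat \<Rightarrow> (real^'n) set \<Rightarrow> (nat \<Rightarrow> (real^'n) set) set" where
  "admissible_sets N \<Omega> =
     {W \<in> {1..N} \<rightarrow>\<^sub>E {A \<in> sets borel. A \<subseteq> \<Omega>}. disjoint_family_on W {1..N}}"

definition admissible_pairs ::
  "nat \<Rightarrow> (real^'n) set \<Rightarrow> ((nat \<Rightarrow> real^'n \<Rightarrow> real) \<times> (nat \<Rightarrow> (real^'n) set)) set" where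
  "admissible_pairs N \<Omega> =
     {(u, W). W \<in> admissible_sets N \<Omega> \<and> u \<in> {1..N} \<rightarrow>\<^sub>E W12 \<and>
        (\<forall>i\<in>{1..N}. AE x in lebesgue. x \<notin> W i \<longrightarrow> u i x = 0)}"

text \<open>\<open>f i\<close> and \<open>g i\<close> are only given on \<open>\<Omega>\<close>, outside of which \<open>u i\<close> vanishes almost everywhere.\<close>

definition J_functional ::
  "nat \<Rightarrow> (real^'n) set \<Rightarrow> (nat \<Rightarrow> real^'n \<Rightarrow> real) \<Rightarrow> (nat \<Rightarrow> real^'n \<Rightarrow> real) \<Rightarrow>
   ((nat \<Rightarrow> (real^'n) set) \<Rightarrow> real) \<Rightarrow>
   (nat \<Rightarrow> real^'n \<Rightarrow> real) \<Rightarrow> (nat \<Rightarrow> (real^'n) set) \<Rightarrow> real" where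
  "J_functional N \<Omega> f g F u W =
     (\<Sum>i=1..N. LINT x|lebesgue. (norm (distr_gradient (u i) x))\<^sup>2)
     + (\<Sum>i=1..N. LINT x|lebesgue_on \<Omega>. (u i x)\<^sup>2 * f i x - u i x * g i x)
     + F W"

definition J_integrals_converge ::
  "nat \<Rightarrow> (real^'n) set \<Rightarrow> (nat \<Rightarrow> real^'n \<Rightarrow> real) \<Rightarrow> (nat \<Rightarrow> real^'n \<Rightarrow> real) \<Rightarrow> bool" where
  "J_integrals_converge N \<Omega> f g \<longleftrightarrow>
     (\<forall>(u, W) \<in> admissible_pairs N \<Omega>. \<forall>i\<in>{1..N}.
        integrable (lebesgue_on \<Omega>) (\<lambda>x. (u i x)\<^sup>2 * f i x - u i x * g i x))"

definition is_minimizer ::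
  "nat \<Rightarrow> (real^'n) set \<Rightarrow> (nat \<Rightarrow> real^'n \<Rightarrow> real) \<Rightarrow> (nat \<Rightarrow> real^'n \<Rightarrow> real) \<Rightarrow>
   ((nat \<Rightarrow> (real^'n) set) \<Rightarrow> real) \<Rightarrow>
   (nat \<Rightarrow> real^'n \<Rightarrow> real) \<Rightarrow> (nat \<Rightarrow> (real^'n) set) \<Rightarrow> bool" where
  "is_minimizer N \<Omega> f g F u W \<longleftrightarrow>
     (u, W) \<in> admissible_pairs N \<Omega> \<and>
     (\<forall>(u', W') \<in> admissible_pairs N \<Omega>.
        J_functional N \<Omega> f g F u W \<le> J_functional N \<Omega> f g F u' W')"

text \<open>The sets are Borel because \<open>F\<close> is only meaningful on \<^const>\<open>admissible_sets\<close>.\<close>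

definition nondegenerate ::
  "nat \<Rightarrow> ((nat \<Rightarrow> (real^'n) set) \<Rightarrow> real) \<Rightarrow> (nat \<Rightarrow> (real^'n) set) \<Rightarrow> real \<Rightarrow> real \<Rightarrow> bool" where
  "nondegenerate N F W lam \<epsilon> \<longleftrightarrow>
     (\<forall>A \<in> sets borel. A \<subseteq> W 1 \<longrightarrow> 0 < measure lebesgue A \<longrightarrow> measure lebesgue A \<le> \<epsilon> \<longrightarrow>
        (\<exists>B. (\<forall>j\<in>{2..N}. B j \<in> sets borel \<and> B j \<subseteq> A) \<and> disjoint_family_on B {2..N} \<and>
           F (\<lambda>i\<in>{1..N}. if i = 1 then W 1 - A else W i \<union> B i) \<le> F W - lam * measure lebesgue A))"

text \<open>On a null set \<open>\<Omega>\<close> the essential supremum is \<open>-\<infinity>\<close>, which \<^const>\<open>real_of_ereal\<close> sends to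
  \<open>0\<close>, the correct norm.\<close>

definition ess_bounded :: "(real^'n) set \<Rightarrow> (real^'n \<Rightarrow> real) \<Rightarrow> bool" where
  "ess_bounded \<Omega> h \<longleftrightarrow> esssup (lebesgue_on \<Omega>) (\<lambda>x. ereal \<bar>h x\<bar>) < \<infinity>"

definition Linf_norm :: "(real^'n) set \<Rightarrow> (real^'n \<Rightarrow> real) \<Rightarrow> real" where
  "Linf_norm \<Omega> h = real_of_ereal (esssup (lebesgue_on \<Omega>) (\<lambda>x. ereal \<bar>h x\<bar>))"

definition positive_region :: "(real^'n) set \<Rightarrow> (real^'n \<Rightarrow> real) \<Rightarrow> (real^'n) set" where
  "positive_region \<Omega> v = {x \<in> \<Omega>. v x > 0}"

end

theory Submission
  imports Defs
begin

text \<open>Write \<open>u\<close> for \<open>u 1\<close>, and let \<open>x\<close> be a point where \<open>u > 0\<close>.  Two competitors for the minimizer are compared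
with it at a scale \<open>s\<close> that is a small multiple \<open>\<kappa>\<close> of \<open>min (\<delta> x) (min (\<epsilon> powr (1 / n)) 1)\<close>.  If
\<open>u x \<ge> s\<close> there is nothing to prove.  Otherwise the Lipschitz bound gives \<open>u \<le> C * s\<close> on
\<open>ball x (4 * s)\<close>, with \<open>C = 1 + 4 * C0\<close>.

First competitor: multiply \<open>u\<close> by a smooth function that vanishes on \<open>ball x s\<close> and is \<open>1\<close> outside
\<open>ball x (2 * s)\<close>, and give \<open>W 1 \<inter> ball x s\<close> away.  Nondegeneracy says that \<open>F\<close> drops by at least
\<open>lam\<close> times the volume of the ball.  With the multiplier \<open>1 - \<chi>\<^sup>2\<close>, the decrease of the coefficient of
the gradient of \<open>u\<close> absorbs the mixed term, so the Dirichlet energy grows by at most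
\<open>8 * u\<^sup>2 * |\<nabla>\<chi>|\<^sup>2\<close>, integrated.  Since \<open>u \<le> C * s\<close>,
minimality forces \<open>lam * s ^ n \<lesssim> (1 / s) * \<integral> u\<close> over \<open>cball x (2 * s)\<close>
(\<open>removing_ball_energy_bound\<close>).

Second competitor: \<open>u + \<tau> * \<psi>\<close> with \<open>\<tau> > 0\<close> and a nonnegative test function \<open>\<psi>\<close> supported where
\<open>u > 0\<close>, the sets being kept.  The first variation gives \<open>\<integral> u * \<Delta>\<psi> \<le> K * \<integral> \<psi>\<close>, that is,
\<open>\<Delta>u \<le> K\<close> in the weak sense (\<open>minimizer_weak_supersolution\<close>).  Hence smooth ball averages
of \<open>u\<close> exceed \<open>u x\<close> by at most a multiple of \<open>K * s\<^sup>2\<close>, and the integral of \<open>u\<close> over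
\<open>cball x (2 * s)\<close> is \<open>\<lesssim> s ^ n * (u x + K * s\<^sup>2)\<close> (\<open>supersolution_ball_integral_le\<close>).

Together, \<open>lam \<le> C4 * (u x / s + 2 * K * s)\<close>.  Because \<open>s \<le> \<kappa>\<close>, a small \<open>\<kappa>\<close> makes the last term at
most \<open>lam / 2\<close>, and \<open>u x\<close> is bounded below by a multiple of \<open>s\<close>.

To compare energies one has to know that the distributional gradient is unique up to null sets and
how it behaves under sums and smooth multiples; this is what the first half of the text provides.\<close>

section \<open>Calculus of smooth functions\<close>

lemma cont_diff_SucI:
  fixes f :: "real^'n \<Rightarrow> real"
  assumes "\<And>x. (f has_derivative f' x) (at x)" and "\<And>v. cont_diff k (\<lambda>x. f' x v)"
  shows "cont_diff (Suc k) f"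
proof -
  have "frechet_derivative f (at x) = f' x" for x
    using frechet_derivative_at[OF assms(1)[of x]] by simp
  then show ?thesis using assms by (auto simp: differentiable_def)
qed

lemma cont_diff_SucE:
  fixes f :: "real^'n \<Rightarrow> real"
  assumes "cont_diff (Suc k) f"
  shows "(f has_derivative frechet_derivative f (at x)) (at x)"
    and "cont_diff k (\<lambda>x. frechet_derivative f (at x) v)"
  using assms frechet_derivative_works by auto

lemma cont_diff_Suc_imp:
  fixes f :: "real^'n \<Rightarrow> real"
  shows "cont_diff (Suc k) f \<Longrightarrow> cont_diff k f"
proof (induction k arbitrary: f)
  case 0
  then show ?case
    by (auto simp: continuous_on_eq_continuous_at intro!: differentiable_imp_continuous_within)
next
  case (Suc k)
  show ?case
    by (rule cont_diff_SucI[OF cont_diff_SucE(1)[OF Suc.prems]])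
       (rule Suc.IH[OF cont_diff_SucE(2)[OF Suc.prems]])
qed

lemma cont_diff_const: "cont_diff k (\<lambda>x::real^'n. c)"
proof (induction k arbitrary: c)
  case (Suc k)
  show ?case
    by (rule cont_diff_SucI[where f' = "\<lambda>_ _. 0"]) (auto simp: Suc)
qed auto

lemma cont_diff_inner: "cont_diff k (\<lambda>x::real^'n. (x - a) \<bullet> v)"
proof (cases k)
  case 0
  then show ?thesis by (auto intro!: continuous_intros)
next
  case (Suc m)
  show ?thesis unfolding Suc
    by (rule cont_diff_SucI[where f' = "\<lambda>_ w. w \<bullet> v"])
       (auto simp: cont_diff_const intro!: derivative_eq_intros)
qed

lemma cont_diff_add:
  fixes f g :: "real^'n \<Rightarrow> real"
  shows "cont_diff k f \<Longrightarrow> cont_diff k g \<Longrightarrow> cont_diff k (\<lambda>x. f x + g x)"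
proof (induction k arbitrary: f g)
  case (Suc k)
  note f = cont_diff_SucE[OF Suc.prems(1)] and g = cont_diff_SucE[OF Suc.prems(2)]
  show ?case
    by (rule cont_diff_SucI[OF has_derivative_add[OF f(1) g(1)]]) (rule Suc.IH[OF f(2) g(2)])
qed (auto intro: continuous_intros)

lemma cont_diff_mult:
  fixes f g :: "real^'n \<Rightarrow> real"
  shows "cont_diff k f \<Longrightarrow> cont_diff k g \<Longrightarrow> cont_diff k (\<lambda>x. f x * g x)"
proof (induction k arbitrary: f g)
  case (Suc k)
  note f = cont_diff_SucE[OF Suc.prems(1)] and g = cont_diff_SucE[OF Suc.prems(2)]
  show ?case
    by (rule cont_diff_SucI[OF has_derivative_mult[OF f(1) g(1)]])
       (intro cont_diff_add Suc.IH f(2) g(2) cont_diff_Suc_imp[OF Suc.prems(1)]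
         cont_diff_Suc_imp[OF Suc.prems(2)])
qed (auto intro: continuous_intros)

lemma cont_diff_sqnorm: "cont_diff k (\<lambda>x::real^'n. (x - a) \<bullet> (x - a))"
proof (cases k)
  case 0
  then show ?thesis by (auto intro!: continuous_intros)
next
  case (Suc m)
  show ?thesis unfolding Suc
  proof (rule cont_diff_SucI)
    show "((\<lambda>x. (x - a) \<bullet> (x - a)) has_derivative (\<lambda>w. (x - a) \<bullet> w + (x - a) \<bullet> w)) (at x)"
      for x :: "real^'n"
      by (auto simp: inner_commute intro!: derivative_eq_intros)
  qed (intro cont_diff_add cont_diff_inner)
qed

lemma cont_diff_prod:
  fixes f :: "'i \<Rightarrow> real^'n \<Rightarrow> real"
  assumes "\<And>i. i \<in> I \<Longrightarrow> cont_diff k (f i)"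
  shows "cont_diff k (\<lambda>x. \<Prod>i\<in>I. f i x)"
  using assms
  by (induction I rule: infinite_finite_induct) (auto intro: cont_diff_const cont_diff_mult)

text \<open>Stated for a whole sequence of successive derivatives, because the chain rule takes \<open>h j\<close> to
\<open>h (Suc j)\<close> and the induction has to move along the sequence.\<close>

lemma cont_diff_compose:
  fixes f :: "real^'n \<Rightarrow> real"
  assumes h: "\<And>j t. (h j has_real_derivative h (Suc j) t) (at t)"
  shows "cont_diff k f \<Longrightarrow> cont_diff k (\<lambda>x. h j (f x))"
proof (induction k arbitrary: j)
  case 0
  have "continuous_on UNIV (h j)"
    by (meson DERIV_isCont continuous_at_imp_continuous_on h)
  then show ?case using 0 by (auto intro: continuous_on_compose2)
next
  case (Suc k)
  note f = cont_diff_SucE[OF Suc.prems]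
  have "((\<lambda>x. h j (f x)) has_derivative (\<lambda>v. frechet_derivative f (at x) v * h (Suc j) (f x))) (at x)" for x
    using has_derivative_compose[OF f(1)[of x] h[of j "f x", unfolded has_field_derivative_def]]
    by (simp add: mult.commute)
  then show ?case
    by (rule cont_diff_SucI) (intro cont_diff_mult f(2) Suc.IH cont_diff_Suc_imp[OF Suc.prems])
qed

section \<open>The flat function and its derivatives\<close>

text \<open>The recursion is read off from
\<open>(P (1 / t) * exp (- 1 / t))' = (1 / t)\<^sup>2 * (P (1 / t) - P' (1 / t)) * exp (- 1 / t)\<close>.\<close>

fun flat_poly :: "nat \<Rightarrow> real poly" where
  "flat_poly 0 = 1"
| "flat_poly (Suc j) = [:0, 0, 1:] * (flat_poly j - pderiv (flat_poly j))"

text \<open>The \<open>j\<close>-th derivative of the smooth function that is \<open>exp (- 1 / t)\<close> for \<open>t > 0\<close> and \<open>0\<close> for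
\<open>t \<le> 0\<close>.  All bumps and cutoffs below are built from it.\<close>

definition flat :: "nat \<Rightarrow> real \<Rightarrow> real" where
  "flat j t = (if t > 0 then poly (flat_poly j) (1 / t) * exp (- 1 / t) else 0)"

text \<open>The factor \<open>s ^ m\<close> makes the induction on \<open>p\<close> go through: passing from \<open>p\<close> to \<open>pCons a p\<close> multiplies
by \<open>s\<close>.\<close>

lemma poly_times_exp_neg_tendsto_0:
  "((\<lambda>s::real. s ^ m * poly p s * exp (- s)) \<longlongrightarrow> 0) at_top"
proof (induction p arbitrary: m)
  case 0
  then show ?case by simp
next
  case (pCons a p)
  have "((\<lambda>s. a * (s ^ m / exp s) + s ^ Suc m * poly p s * exp (- s)) \<longlongrightarrow> a * 0 + 0) at_top"
    by (intro tendsto_intros pCons.IH tendsto_power_div_exp_0)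
  then show ?case by (simp add: algebra_simps exp_minus divide_inverse)
qed

text \<open>Only \<open>t = 0\<close> needs an argument: there the difference quotient from the right is, with \<open>s = 1 / t\<close>,
a polynomial in \<open>s\<close> times \<open>exp (- s)\<close>.\<close>

lemma flat_has_real_derivative: "(flat j has_real_derivative flat (Suc j) t) (at t)"
proof -
  consider "t > 0" | "t < 0" | "t = 0" by linarith
  then show ?thesis
  proof cases
    case 1
    have "((\<lambda>t. poly (flat_poly j) (1 / t) * exp (- 1 / t)) has_real_derivative flat (Suc j) t) (at t)"
      using 1 by (auto simp: flat_def field_simps power2_eq_square
        intro!: derivative_eq_intros DERIV_chain2[OF poly_DERIV])
    then show ?thesis
      by (rule has_field_derivative_transform_within_open[of _ _ _ "{0<..}"])
         (use 1 in \<open>auto simp: flat_def\<close>)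
  next
    case 2
    have "((\<lambda>t. 0) has_real_derivative flat (Suc j) t) (at t)"
      using 2 by (auto simp: flat_def)
    then show ?thesis
      by (rule has_field_derivative_transform_within_open[of _ _ _ "{..<0}"])
         (use 2 in \<open>auto simp: flat_def\<close>)
  next
    case 3
    have "((\<lambda>t. (flat j t - flat j 0) / (t - 0)) \<longlongrightarrow> 0) (at_right 0)"
    proof -
      have "((\<lambda>t::real. (1 / t) ^ 1 * poly (flat_poly j) (1 / t) * exp (- (1 / t))) \<longlongrightarrow> 0) (at_right 0)"
        using filterlim_compose[OF poly_times_exp_neg_tendsto_0[of 1 "flat_poly j"]
            filterlim_inverse_at_top_right] by (simp add: inverse_eq_divide)
      then show ?thesis
        by (rule Lim_transform_eventually)
           (auto simp: eventually_at_filter flat_def intro!: always_eventually)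
    qed
    moreover have "((\<lambda>t. (flat j t - flat j 0) / (t - 0)) \<longlongrightarrow> 0) (at_left 0)"
      by (rule Lim_transform_eventually[OF tendsto_const])
         (auto simp: eventually_at_filter flat_def intro!: always_eventually)
    ultimately show ?thesis
      unfolding 3 has_field_derivative_iff by (simp add: flat_def filterlim_at_split)
  qed
qed

lemma flat_0: "flat 0 t = (if t > 0 then exp (- 1 / t) else 0)"
  by (simp add: flat_def)

lemma flat_1: "flat (Suc 0) t = (if t > 0 then (1 / t)\<^sup>2 * exp (- 1 / t) else 0)"
  by (simp add: flat_def power2_eq_square)

lemma flat_nonpos: "t \<le> 0 \<Longrightarrow> flat j t = 0"
  by (simp add: flat_def)

lemma flat_0_bounds: "0 \<le> flat 0 t" "flat 0 t \<le> 1"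
  by (auto simp: flat_0)

lemma flat_1_bounds: "0 \<le> flat (Suc 0) t" "flat (Suc 0) t \<le> 2"
proof -
  have "s\<^sup>2 * exp (- s) \<le> 2" if "s > 0" for s :: real
    using exp_lower_Taylor_quadratic[of s] that by (simp add: exp_minus field_simps)
  from this[of "1 / t"] show "flat (Suc 0) t \<le> 2" by (auto simp: flat_1)
qed (auto simp: flat_1)

lemma continuous_on_flat: "continuous_on S (flat j)"
  by (meson DERIV_isCont continuous_at_imp_continuous_on flat_has_real_derivative)

lemma cont_diff_flat:
  fixes f :: "real^'n \<Rightarrow> real"
  shows "cont_diff k f \<Longrightarrow> cont_diff k (\<lambda>x. flat j (f x))"
  by (rule cont_diff_compose[of flat, OF flat_has_real_derivative])

section \<open>Test functions and integration by parts\<close>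

definition gradient :: "(real^'n \<Rightarrow> real) \<Rightarrow> real^'n \<Rightarrow> real^'n" where
  "gradient f x = (\<chi> i. frechet_derivative f (at x) (axis i 1))"

lemma cont_diff_imp_continuous:
  assumes "\<And>k. cont_diff k f" shows "continuous_on S f"
  using assms[of 0] continuous_on_subset by auto

lemma cont_diff_imp_continuous_partial:
  assumes "\<And>k. cont_diff k f" shows "continuous_on S (\<lambda>x. frechet_derivative f (at x) v)"
  using cont_diff_SucE(2)[OF assms] by (rule cont_diff_imp_continuous)

lemma cont_diff_imp_continuous_gradient:
  assumes "\<And>k. cont_diff k f" shows "continuous_on S (gradient f)"
  unfolding gradient_def
  by (intro continuous_on_vec_lambda cont_diff_imp_continuous_partial assms)

lemma test_functionI:
  assumes "\<And>k. cont_diff k \<phi>" "bounded {x. \<phi> x \<noteq> 0}"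
  shows "test_function \<phi>"
  using assms by (simp add: test_function_def compact_closure)

lemma test_functionD:
  assumes "test_function \<phi>"
  shows "cont_diff k \<phi>" "bounded {x. \<phi> x \<noteq> 0}" "continuous_on S \<phi>"
    "(\<phi> has_derivative frechet_derivative \<phi> (at x)) (at x)"
  using assms cont_diff_imp_continuous[of \<phi> S] cont_diff_SucE(1)[of 0 \<phi>] compact_closure
  unfolding test_function_def by blast+

lemma frechet_derivative_zero_off_closure:
  assumes "x \<notin> closure {x. f x \<noteq> 0}"
  shows "frechet_derivative f (at x) v = (0::real)"
proof -
  have "((\<lambda>x. 0) has_derivative (\<lambda>_. 0)) (at x)" by simp
  then have "(f has_derivative (\<lambda>_. 0)) (at x)"
  proof (rule has_derivative_transform_within_open)
    show "open (- closure {x. f x \<noteq> 0})" "x \<in> - closure {x. f x \<noteq> 0}" using assms by auto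
    show "0 = f y" if "y \<in> - closure {x. f x \<noteq> 0}" for y
      using that closure_subset[of "{x. f x \<noteq> 0}"] by (metis (mono_tags, lifting) ComplD mem_Collect_eq subsetD)
  qed
  from frechet_derivative_at[OF this] show ?thesis by metis
qed

lemma test_function_partial:
  assumes "test_function \<phi>"
  shows "test_function (\<lambda>x. frechet_derivative \<phi> (at x) v)"
proof (rule test_functionI)
  have "{x. frechet_derivative \<phi> (at x) v \<noteq> 0} \<subseteq> closure {x. \<phi> x \<noteq> 0}"
    using frechet_derivative_zero_off_closure by blast
  then show "bounded {x. frechet_derivative \<phi> (at x) v \<noteq> 0}"
    using bounded_subset bounded_closure test_functionD(2)[OF assms] by blast
qed (rule cont_diff_SucE(2)[OF test_functionD(1)[OF assms]])

lemma test_function_mult: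
  assumes "\<And>k. cont_diff k f" "test_function \<phi>"
  shows "test_function (\<lambda>x. f x * \<phi> x)"
  by (rule test_functionI)
     (auto intro: cont_diff_mult assms test_functionD(1) bounded_subset[OF test_functionD(2)[OF assms(2)]])

lemma frechet_derivative_mult:
  assumes f: "\<And>k. cont_diff k f" and g: "\<And>k. cont_diff k g"
  shows "frechet_derivative (\<lambda>x. f x * g x) (at x) v
    = f x * frechet_derivative g (at x) v + frechet_derivative f (at x) v * g x"
  using fun_cong[OF frechet_derivative_at[OF has_derivative_mult[OF cont_diff_SucE(1)[OF f] cont_diff_SucE(1)[OF g]]], of x v]
  by simp

lemma integrable_continuous_bounded_support:
  fixes f :: "'a::euclidean_space \<Rightarrow> 'b::{banach, second_countable_topology}"
  assumes "continuous_on UNIV f" "bounded {x. f x \<noteq> 0}"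
  shows "integrable lebesgue f"
proof -
  obtain a b where ab: "{x. f x \<noteq> 0} \<subseteq> cbox a b"
    using bounded_subset_cbox_symmetric[OF assms(2)] by blast
  have "integrable lborel (\<lambda>x. indicator (cbox a b) x *\<^sub>R f x)"
    by (rule borel_integrable_compact) (auto intro: continuous_on_subset[OF assms(1)])
  moreover have "(\<lambda>x. indicator (cbox a b) x *\<^sub>R f x) = f"
    using ab by (auto simp: indicator_def fun_eq_iff)
  ultimately show ?thesis
    by (simp add: integrable_completion borel_measurable_integrable)
qed

lemma lebesgue_integral_eq_cbox_integral:
  fixes f :: "'a::euclidean_space \<Rightarrow> 'b::euclidean_space"
  assumes "continuous_on UNIV f" "\<And>x. x \<notin> cbox a b \<Longrightarrow> f x = 0"
  shows "(LINT x|lebesgue. f x) = integral (cbox a b) f"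
proof -
  have "integrable lebesgue f"
    by (rule integrable_continuous_bounded_support)
       (use assms in \<open>auto intro: bounded_subset[OF bounded_cbox[of a b]]\<close>)
  then have "(f has_integral (LINT x|lebesgue. f x)) UNIV"
    by (rule has_integral_integral_lebesgue)
  moreover have "(f has_integral integral (cbox a b) f) UNIV"
    by (rule has_integral_on_superset[OF integrable_integral])
       (use assms in \<open>auto intro: integrable_continuous continuous_on_subset\<close>)
  ultimately show ?thesis by (rule has_integral_unique)
qed

lemma lebesgue_integral_translate:
  fixes f :: "'a::euclidean_space \<Rightarrow> real"
  assumes "continuous_on UNIV f"
  shows "(LINT x|lebesgue. f (x + c)) = (LINT x|lebesgue. f x)"
proof -
  have [measurable]: "f \<in> borel_measurable borel"
    using assms by (rule borel_measurable_continuous_onI)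
  have "(LINT x|lborel. f (x + c)) = (LINT x|distr lborel borel ((+) c). f x)"
    by (subst integral_distr) (auto simp: add.commute)
  then show ?thesis
    by (simp add: lborel_distr_plus integral_completion)
qed

text \<open>The integral of a translate of \<open>\<theta>\<close> does not depend on the translation, so its derivative in the
direction \<open>v\<close>, which is the integral of the partial derivative, vanishes.\<close>

lemma integral_partial_derivative_eq_0:
  fixes \<theta> :: "real^'n \<Rightarrow> real"
  assumes \<theta>: "test_function \<theta>"
  shows "(LINT x|lebesgue. frechet_derivative \<theta> (at x) v) = 0"
proof -
  let ?D = "\<lambda>x. frechet_derivative \<theta> (at x) v"
  obtain r where r: "\<And>x. \<theta> x \<noteq> 0 \<Longrightarrow> norm x \<le> r"
    using test_functionD(2)[OF \<theta>] by (auto simp: bounded_iff)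
  obtain c :: "real^'n" where c: "cball 0 (r + norm v) \<subseteq> cbox (- c) c"
    using bounded_subset_cbox_symmetric[OF bounded_cball] by blast
  have contD: "continuous_on UNIV ?D"
    using test_functionD(3)[OF test_function_partial[OF \<theta>]] .
  \<comment> \<open>One box contains the supports of \<open>\<theta>\<close> and of its translates by \<open>t *\<^sub>R v\<close>, so that differentiation
  under the integral takes place over a fixed compact set.\<close>
  have supp: "\<theta> (x + t *\<^sub>R v) = 0" if "t \<in> {-1<..<1}" "x \<notin> cbox (- c) c" for x :: "real^'n" and t
  proof (rule ccontr)
    assume "\<theta> (x + t *\<^sub>R v) \<noteq> 0"
    then have "norm (x + t *\<^sub>R v) \<le> r" by (rule r)
    then have "norm x \<le> r + norm (t *\<^sub>R v)"
      by (metis add_diff_cancel_right' add_mono_thms_linordered_semiring(3) norm_triangle_ineq4 order_trans)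
    moreover have "norm (t *\<^sub>R v) \<le> norm v"
      using that(1) by (auto intro!: mult_left_le_one_le)
    ultimately have "x \<in> cball 0 (r + norm v)" by (simp add: mem_cball_0)
    then show False using c that(2) by blast
  qed
  have "((\<lambda>t. integral (cbox (- c) c) (\<lambda>x. \<theta> (x + t *\<^sub>R v))) has_field_derivative
      integral (cbox (- c) c) (\<lambda>x. ?D (x + 0 *\<^sub>R v))) (at 0 within {-1<..<1})"
  proof (rule leibniz_rule_field_derivative)
    fix t :: real and x :: "real^'n"
    have "((\<lambda>t. x + t *\<^sub>R v) has_derivative (\<lambda>h. h *\<^sub>R v)) (at t)"
      by (auto intro!: derivative_eq_intros)
    from has_derivative_compose[OF this test_functionD(4)[OF \<theta>]]
    have "((\<lambda>t. \<theta> (x + t *\<^sub>R v)) has_derivative (\<lambda>h. frechet_derivative \<theta> (at (x + t *\<^sub>R v)) (h *\<^sub>R v))) (at t)" .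
    also have "(\<lambda>h. frechet_derivative \<theta> (at (x + t *\<^sub>R v)) (h *\<^sub>R v)) = (*) (?D (x + t *\<^sub>R v))"
      using linear_scale[OF has_derivative_linear[OF test_functionD(4)[OF \<theta>]]]
      by (simp add: fun_eq_iff mult.commute)
    finally show "((\<lambda>t. \<theta> (x + t *\<^sub>R v)) has_field_derivative ?D (x + t *\<^sub>R v)) (at t within {-1<..<1})"
      by (simp add: has_field_derivative_def has_derivative_at_withinI)
  next
    fix t :: real
    show "(\<lambda>x. \<theta> (x + t *\<^sub>R v)) integrable_on cbox (- c) c"
      by (intro integrable_continuous continuous_on_compose2[OF test_functionD(3)[OF \<theta>, of UNIV]]
          continuous_intros) auto
  next
    have "continuous_on UNIV (\<lambda>p :: real \<times> (real^'n). ?D (snd p + fst p *\<^sub>R v))"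
      by (rule continuous_on_compose2[OF contD]) (auto intro!: continuous_intros)
    then show "continuous_on ({-1<..<1} \<times> cbox (- c) c) (\<lambda>(t, x). ?D (x + t *\<^sub>R v))"
      by (auto simp: split_def intro: continuous_on_subset)
  qed auto
  then have D: "((\<lambda>t. integral (cbox (- c) c) (\<lambda>x. \<theta> (x + t *\<^sub>R v))) has_field_derivative
      integral (cbox (- c) c) ?D) (at 0)"
    by (simp add: at_within_open[of 0 "{-1<..<1}"])
  have const: "integral (cbox (- c) c) (\<lambda>x. \<theta> (x + t *\<^sub>R v)) = (LINT x|lebesgue. \<theta> x)"
    if "t \<in> {-1<..<1}" for t
  proof -
    have "integral (cbox (- c) c) (\<lambda>x. \<theta> (x + t *\<^sub>R v)) = (LINT x|lebesgue. \<theta> (x + t *\<^sub>R v))"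
      by (rule lebesgue_integral_eq_cbox_integral[symmetric])
         (use supp[OF that] in \<open>auto intro!: continuous_on_compose2[OF test_functionD(3)[OF \<theta>, of UNIV]] continuous_intros\<close>)
    then show ?thesis by (simp add: lebesgue_integral_translate test_functionD(3)[OF \<theta>])
  qed
  have "((\<lambda>t. LINT x|lebesgue. \<theta> x) has_field_derivative integral (cbox (- c) c) ?D) (at 0)"
    by (rule has_field_derivative_transform_within_open[OF D, of "{-1<..<1}"]) (use const in auto)
  then have "integral (cbox (- c) c) ?D = 0"
    using DERIV_const DERIV_unique by blast
  moreover have "(LINT x|lebesgue. ?D x) = integral (cbox (- c) c) ?D"
  proof (rule lebesgue_integral_eq_cbox_integral[OF contD])
    fix x assume x: "x \<notin> cbox (- c) c"
    have "{x. \<theta> x \<noteq> 0} \<subseteq> cbox (- c) c" using supp[of 0] by auto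
    then have "closure {x. \<theta> x \<noteq> 0} \<subseteq> cbox (- c) c" by (simp add: closure_minimal closed_cbox)
    then show "?D x = 0" using x frechet_derivative_zero_off_closure by blast
  qed
  ultimately show ?thesis by simp
qed

lemma integrable_times_test_function:
  assumes "continuous_on UNIV u" "test_function \<phi>"
  shows "integrable lebesgue (\<lambda>x. u x * \<phi> x :: real)"
  by (rule integrable_continuous_bounded_support)
     (auto intro!: continuous_intros assms(1) test_functionD(3)[OF assms(2)] bounded_subset[OF test_functionD(2)[OF assms(2)]])

section \<open>Rules for distributional gradients\<close>

lemma has_distr_gradient_smooth:
  fixes f :: "real^'n \<Rightarrow> real"
  assumes f: "\<And>k. cont_diff k f"
  shows "has_distr_gradient f (gradient f)"
  unfolding has_distr_gradient_def
proof (intro allI impI)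
  fix \<phi> :: "real^'n \<Rightarrow> real" and i assume \<phi>: "test_function \<phi>"
  let ?e = "axis i 1 :: real^'n"
  note g = test_functionD[OF \<phi>]
  have "0 = (LINT x|lebesgue. f x * frechet_derivative \<phi> (at x) ?e + frechet_derivative f (at x) ?e * \<phi> x)"
    using integral_partial_derivative_eq_0[OF test_function_mult[OF f \<phi>], of ?e]
    by (simp add: frechet_derivative_mult[OF f g(1)])
  also have "\<dots> = (LINT x|lebesgue. f x * frechet_derivative \<phi> (at x) ?e)
      + (LINT x|lebesgue. frechet_derivative f (at x) ?e * \<phi> x)"
    by (intro Bochner_Integration.integral_add integrable_times_test_function test_function_partial \<phi>
        cont_diff_imp_continuous[OF f] cont_diff_imp_continuous_partial[OF f])
  finally show "(LINT x|lebesgue. f x * frechet_derivative \<phi> (at x) ?e) = - (LINT x|lebesgue. gradient f x $ i * \<phi> x)"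
    by (simp add: gradient_def)
qed

lemma L2_fields_measurable: "G \<in> L2_fields \<Longrightarrow> G \<in> borel_measurable lebesgue"
  by (simp add: L2_fields_def)

lemma measurable_component:
  fixes G :: "'a \<Rightarrow> real^'n"
  assumes "G \<in> borel_measurable M" shows "(\<lambda>x. G x $ i) \<in> borel_measurable M"
  using borel_measurable_inner[OF assms borel_measurable_const[of "axis i 1"]]
  by (simp add: inner_axis)

lemma lebesgue_measurable_continuous:
  fixes f :: "'a::euclidean_space \<Rightarrow> 'b::topological_space"
  assumes "continuous_on UNIV f" shows "f \<in> borel_measurable lebesgue"
  using borel_measurable_continuous_onI[OF assms] by (intro measurable_completion) simp

lemma integrable_square_continuous_bounded_support:
  fixes f :: "'a::euclidean_space \<Rightarrow> 'b::real_normed_vector"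
  assumes "continuous_on UNIV f" "bounded {x. f x \<noteq> 0}"
  shows "integrable lebesgue (\<lambda>x. (norm (f x))\<^sup>2)"
  by (rule integrable_continuous_bounded_support)
     (auto intro!: continuous_intros assms(1) bounded_subset[OF assms(2)])

lemma L2_fields_add:
  assumes "G \<in> L2_fields" "H \<in> L2_fields"
  shows "(\<lambda>x. G x + H x) \<in> L2_fields"
proof -
  have [measurable]: "G \<in> borel_measurable lebesgue" "H \<in> borel_measurable lebesgue"
    using assms by (auto simp: L2_fields_def)
  have le: "norm ((norm (a + b))\<^sup>2) \<le> norm (2 * (norm a)\<^sup>2 + 2 * (norm b)\<^sup>2)" for a b :: "real^'n"
  proof -
    have "(norm (a + b))\<^sup>2 \<le> (norm a + norm b)\<^sup>2"
      by (intro power_mono norm_triangle_ineq) auto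
    also have "\<dots> \<le> 2 * (norm a)\<^sup>2 + 2 * (norm b)\<^sup>2"
      using sum_squares_bound[of "norm a" "norm b"] by (simp add: power2_sum)
    finally show ?thesis by simp
  qed
  have "integrable lebesgue (\<lambda>x. 2 * (norm (G x))\<^sup>2 + 2 * (norm (H x))\<^sup>2)"
    using assms by (simp add: L2_fields_def)
  then have "integrable lebesgue (\<lambda>x. (norm (G x + H x))\<^sup>2)"
    by (rule Bochner_Integration.integrable_bound) (measurable, intro AE_I2 le)
  then show ?thesis by (simp add: L2_fields_def)
qed

lemma L2_fields_scale:
  assumes "G \<in> L2_fields" "h \<in> borel_measurable lebesgue" "\<And>x. \<bar>h x\<bar> \<le> c"
  shows "(\<lambda>x. h x *\<^sub>R G x) \<in> L2_fields"
proof -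
  have [measurable]: "G \<in> borel_measurable lebesgue" "h \<in> borel_measurable lebesgue"
    using assms by (auto simp: L2_fields_def)
  have le: "norm ((norm (h x *\<^sub>R G x))\<^sup>2) \<le> norm (c\<^sup>2 * (norm (G x))\<^sup>2)" for x
  proof -
    have "\<bar>h x\<bar>\<^sup>2 \<le> c\<^sup>2" using assms(3)[of x] by (intro power_mono) auto
    then show ?thesis by (simp add: power_mult_distrib mult_right_mono)
  qed
  have "integrable lebesgue (\<lambda>x. c\<^sup>2 * (norm (G x))\<^sup>2)"
    using assms(1) by (simp add: L2_fields_def)
  then have "integrable lebesgue (\<lambda>x. (norm (h x *\<^sub>R G x))\<^sup>2)"
    by (rule Bochner_Integration.integrable_bound) (measurable, intro AE_I2 le)
  then show ?thesis by (simp add: L2_fields_def)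
qed

lemma L2_fields_continuous_bounded_support:
  assumes "continuous_on UNIV G" "bounded {x. G x \<noteq> 0}"
  shows "G \<in> L2_fields"
  using integrable_square_continuous_bounded_support[OF assms] lebesgue_measurable_continuous[OF assms(1)]
  by (simp add: L2_fields_def)

lemma integrable_inner_L2_fields:
  assumes "G \<in> L2_fields" "H \<in> L2_fields"
  shows "integrable lebesgue (\<lambda>x. G x \<bullet> H x)"
proof -
  have [measurable]: "G \<in> borel_measurable lebesgue" "H \<in> borel_measurable lebesgue"
    using assms by (auto simp: L2_fields_def)
  have le: "norm (a \<bullet> b) \<le> norm ((norm a)\<^sup>2 + (norm b)\<^sup>2)" for a b :: "real^'n"
  proof -
    have "0 \<le> norm a * norm b" by simp
    then show ?thesis
      using Cauchy_Schwarz_ineq2[of a b] sum_squares_bound[of "norm a" "norm b"]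
      unfolding real_norm_def by linarith
  qed
  have "integrable lebesgue (\<lambda>x. (norm (G x))\<^sup>2 + (norm (H x))\<^sup>2)"
    using assms by (simp add: L2_fields_def)
  then show ?thesis
    by (rule Bochner_Integration.integrable_bound) (measurable, intro AE_I2 le)
qed

lemma integrable_component_times_test_function:
  fixes G :: "real^'n \<Rightarrow> real^'n"
  assumes "G \<in> L2_fields" "test_function \<phi>"
  shows "integrable lebesgue (\<lambda>x. G x $ i * \<phi> x)"
proof -
  have "(\<lambda>x. \<phi> x *\<^sub>R axis i 1 :: real^'n) \<in> L2_fields"
    by (rule L2_fields_continuous_bounded_support)
       (auto intro!: continuous_intros test_functionD(3)[OF assms(2)] bounded_subset[OF test_functionD(2)[OF assms(2)]])
  from integrable_inner_L2_fields[OF assms(1) this] show ?thesis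
    by (simp add: inner_axis mult.commute)
qed

lemma has_distr_gradient_add:
  fixes u v :: "real^'n \<Rightarrow> real"
  assumes uG: "has_distr_gradient u G" "continuous_on UNIV u" "G \<in> L2_fields"
    and vH: "has_distr_gradient v H" "continuous_on UNIV v" "H \<in> L2_fields"
  shows "has_distr_gradient (\<lambda>x. u x + v x) (\<lambda>x. G x + H x)"
  unfolding has_distr_gradient_def
proof (intro allI impI)
  fix \<phi> :: "real^'n \<Rightarrow> real" and i assume \<phi>: "test_function \<phi>"
  let ?D = "\<lambda>x. frechet_derivative \<phi> (at x) (axis i 1)"
  have "(LINT x|lebesgue. (u x + v x) * ?D x) = (LINT x|lebesgue. u x * ?D x) + (LINT x|lebesgue. v x * ?D x)"
    unfolding distrib_right
    by (intro Bochner_Integration.integral_add integrable_times_test_function test_function_partial uG vH \<phi>)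
  also have "\<dots> = - ((LINT x|lebesgue. G x $ i * \<phi> x) + (LINT x|lebesgue. H x $ i * \<phi> x))"
    using uG(1) vH(1) \<phi> by (simp add: has_distr_gradient_def)
  also have "(LINT x|lebesgue. G x $ i * \<phi> x) + (LINT x|lebesgue. H x $ i * \<phi> x)
     = (LINT x|lebesgue. (G x + H x) $ i * \<phi> x)"
    unfolding vector_add_component distrib_right
    by (intro Bochner_Integration.integral_add[symmetric] integrable_component_times_test_function uG vH \<phi>)
  finally show "(LINT x|lebesgue. (u x + v x) * ?D x) = - (LINT x|lebesgue. (G x + H x) $ i * \<phi> x)" .
qed

lemma has_distr_gradient_mult:
  fixes u \<eta> :: "real^'n \<Rightarrow> real"
  assumes uG: "has_distr_gradient u G" "continuous_on UNIV u" "G \<in> L2_fields"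
    and \<eta>: "\<And>k. cont_diff k \<eta>"
  shows "has_distr_gradient (\<lambda>x. \<eta> x * u x) (\<lambda>x. \<eta> x *\<^sub>R G x + u x *\<^sub>R gradient \<eta> x)"
  unfolding has_distr_gradient_def
proof (intro allI impI)
  fix \<phi> :: "real^'n \<Rightarrow> real" and i assume \<phi>: "test_function \<phi>"
  let ?D = "\<lambda>(f :: real^'n \<Rightarrow> real) x. frechet_derivative f (at x) (axis i 1)"
  note \<eta>\<phi> = test_function_mult[OF \<eta> \<phi>]
  have int1: "integrable lebesgue (\<lambda>x. u x * ?D (\<lambda>x. \<eta> x * \<phi> x) x)"
    by (intro integrable_times_test_function test_function_partial \<eta>\<phi> uG)
  have int2: "integrable lebesgue (\<lambda>x. (u x * ?D \<eta> x) * \<phi> x)"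
    by (intro integrable_times_test_function continuous_intros uG \<phi> cont_diff_imp_continuous_partial[OF \<eta>])
  have int3: "integrable lebesgue (\<lambda>x. G x $ i * (\<eta> x * \<phi> x))"
    by (intro integrable_component_times_test_function \<eta>\<phi> uG)
  have "(LINT x|lebesgue. \<eta> x * u x * ?D \<phi> x)
      = (LINT x|lebesgue. u x * ?D (\<lambda>x. \<eta> x * \<phi> x) x - (u x * ?D \<eta> x) * \<phi> x)"
    by (simp add: frechet_derivative_mult[OF \<eta> test_functionD(1)[OF \<phi>]] algebra_simps)
  also have "\<dots> = (LINT x|lebesgue. u x * ?D (\<lambda>x. \<eta> x * \<phi> x) x) - (LINT x|lebesgue. (u x * ?D \<eta> x) * \<phi> x)"
    by (rule Bochner_Integration.integral_diff[OF int1 int2])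
  also have "(LINT x|lebesgue. u x * ?D (\<lambda>x. \<eta> x * \<phi> x) x) = - (LINT x|lebesgue. G x $ i * (\<eta> x * \<phi> x))"
    using uG(1) \<eta>\<phi> unfolding has_distr_gradient_def by blast
  also have "- (LINT x|lebesgue. G x $ i * (\<eta> x * \<phi> x)) - (LINT x|lebesgue. (u x * ?D \<eta> x) * \<phi> x)
    = - (LINT x|lebesgue. G x $ i * (\<eta> x * \<phi> x) + (u x * ?D \<eta> x) * \<phi> x)"
    by (simp add: Bochner_Integration.integral_add[OF int3 int2])
  finally show "(LINT x|lebesgue. \<eta> x * u x * ?D \<phi> x)
     = - (LINT x|lebesgue. (\<eta> x *\<^sub>R G x + u x *\<^sub>R gradient \<eta> x) $ i * \<phi> x)"
    by (simp add: gradient_def algebra_simps)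
qed

lemma W12_continuousI:
  assumes "continuous_on UNIV u" "G \<in> L2_fields" "has_distr_gradient u G"
  shows "u \<in> W12"
proof -
  have "integrable (lebesgue_on K) (\<lambda>x. (u x)\<^sup>2)" if K: "compact K" for K
  proof -
    have "integrable lborel (\<lambda>x. indicator K x *\<^sub>R (u x)\<^sup>2)"
      by (rule borel_integrable_compact[OF K])
         (auto intro!: continuous_intros continuous_on_subset[OF assms(1)])
    then have "integrable lebesgue (\<lambda>x. indicator K x *\<^sub>R (u x)\<^sup>2)"
      by (simp add: integrable_completion borel_measurable_integrable)
    then show ?thesis
      using K by (subst integrable_restrict_space) (auto simp: lmeasurable_compact fmeasurableD)
  qed
  then show ?thesis
    using assms lebesgue_measurable_continuous[OF assms(1)] by (auto simp: W12_def L2_loc_def)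
qed

section \<open>Uniqueness of distributional gradients\<close>

text \<open>Test functions with values in \<open>[0, 1]\<close> that converge pointwise to the indicator of the open box as \<open>k\<close> tends to infinity.\<close>

definition box_bump :: "real^'n \<Rightarrow> real^'n \<Rightarrow> nat \<Rightarrow> real^'n \<Rightarrow> real" where
  "box_bump a b k y = (\<Prod>i\<in>UNIV. flat 0 (real k * (y $ i - a $ i)) * flat 0 (real k * (b $ i - y $ i)))"

lemma box_bump_eq_0: "y \<notin> box a b \<Longrightarrow> box_bump a b k y = 0"
  unfolding box_bump_def mem_box_cart
  by (auto simp: not_less prod_zero_iff intro!: flat_nonpos mult_nonneg_nonpos)

lemma box_bump_bounds: "0 \<le> box_bump a b k y" "box_bump a b k y \<le> 1"
  unfolding box_bump_def
  by (auto intro!: prod_nonneg prod_le_1 mult_le_one mult_nonneg_nonneg flat_0_bounds simp del: zero_le_mult_iff)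

lemma test_function_box_bump:
  fixes a b :: "real^'n"
  shows "test_function (box_bump a b k)"
proof (rule test_functionI)
  have "real k * (y $ i - a $ i) = (y - a) \<bullet> (real k *\<^sub>R axis i 1)"
    "real k * (b $ i - y $ i) = (y - b) \<bullet> (- real k *\<^sub>R axis i 1)" for y :: "real^'n" and i
    by (simp_all add: inner_axis algebra_simps)
  then have "cont_diff m (\<lambda>y::real^'n. \<Prod>i\<in>UNIV. flat 0 (real k * (y $ i - a $ i)) * flat 0 (real k * (b $ i - y $ i)))" for m
    by (simp only:) (intro cont_diff_prod cont_diff_mult cont_diff_flat cont_diff_inner)
  then show "cont_diff m (box_bump a b k)" for m
    unfolding box_bump_def[abs_def] .
  show "bounded {y. box_bump a b k y \<noteq> 0}"
    by (rule bounded_subset[OF bounded_box[of a b]]) (use box_bump_eq_0 in blast)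
qed

lemma flat_0_scaled_tendsto_1:
  assumes "c > 0" shows "(\<lambda>k. flat 0 (real k * c)) \<longlonglongrightarrow> 1"
proof -
  have "(\<lambda>k. exp (- (1 / c) * (1 / real k))) \<longlonglongrightarrow> exp (- (1 / c) * 0)"
    by (intro tendsto_intros lim_1_over_n)
  moreover have "\<forall>\<^sub>F k in sequentially. exp (- (1 / c) * (1 / real k)) = flat 0 (real k * c)"
    using eventually_gt_at_top[of 0] by eventually_elim (use assms in \<open>auto simp: flat_0 mult.commute\<close>)
  ultimately have "(\<lambda>k. flat 0 (real k * c)) \<longlonglongrightarrow> exp (- (1 / c) * 0)"
    by (rule Lim_transform_eventually)
  then show ?thesis by simp
qed

lemma box_bump_tendsto: "(\<lambda>k. box_bump a b k y) \<longlonglongrightarrow> indicator (box a b) y"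
proof (cases "y \<in> box a b")
  case True
  then have pos: "a $ i < y $ i" "y $ i < b $ i" for i by (auto simp: mem_box_cart)
  have "(\<lambda>k. \<Prod>i\<in>UNIV. flat 0 (real k * (y $ i - a $ i)) * flat 0 (real k * (b $ i - y $ i)))
      \<longlonglongrightarrow> (\<Prod>i\<in>(UNIV::'a set). 1 * 1)"
    by (intro tendsto_intros flat_0_scaled_tendsto_1) (simp_all add: pos)
  then show ?thesis using True unfolding box_bump_def by simp
qed (simp add: box_bump_eq_0)

text \<open>Boxes form a generator of the Borel sets that is stable under intersection.  Inside a fixed large box, the sets over which \<open>h\<close>
integrates to \<open>0\<close> therefore include all Borel sets, which forces \<open>h\<close> to vanish almost everywhere
there.\<close>

lemma AE_eq_0_of_box_integrals:
  fixes h :: "'a::euclidean_space \<Rightarrow> real"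
  assumes meas: "h \<in> borel_measurable lebesgue"
    and int: "\<And>a b. integrable lebesgue (\<lambda>x. indicator (box a b) x * h x)"
    and zero: "\<And>a b. (LINT x|lebesgue. indicator (box a b) x * h x) = 0"
  shows "AE x in lebesgue. h x = 0"
proof -
  \<comment> \<open>A Borel representative, so that the generation of Borel sets by boxes can be used.\<close>
  obtain h' where h'[measurable]: "h' \<in> borel_measurable lborel" and eq: "AE x in lborel. h x = h' x"
    using completion_ex_borel_measurable_real[OF meas] by blast
  have eqL: "AE x in lebesgue. h x = h' x" by (rule AE_completion[OF eq])
  have int': "integrable lborel (\<lambda>x. indicator (box a b) x * h' x)" for a b
  proof -
    have "integrable lebesgue (\<lambda>x. indicator (box a b) x * h' x)"
      by (rule integrable_cong_AE_imp[OF int])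
         (use eqL in \<open>auto intro!: borel_measurable_times borel_measurable_indicator measurable_completion\<close>)
    then show ?thesis by (subst (asm) integrable_completion) auto
  qed
  have zero': "(LINT x|lborel. indicator (box a b) x * h' x) = 0" for a b
  proof -
    have "(LINT x|lborel. indicator (box a b) x * h' x) = (LINT x|lebesgue. indicator (box a b) x * h' x)"
      by (subst integral_completion) auto
    also have "\<dots> = (LINT x|lebesgue. indicator (box a b) x * h x)"
    proof (rule integral_cong_AE)
      show "(\<lambda>x. indicator (box a b) x * h x) \<in> borel_measurable lebesgue"
        using int by (rule borel_measurable_integrable)
    qed (use eqL in \<open>auto intro!: borel_measurable_times borel_measurable_indicator measurable_completion\<close>)
    finally show ?thesis using zero by simp
  qed
  have "AE x in lborel. indicator (box (- (real m *\<^sub>R One)) (real m *\<^sub>R One)) x * h' x = 0" for m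
  proof (rule sigma_finite_measure.density_zero[OF sigma_finite_lborel int'])
    fix A :: "'a set" assume "A \<in> sets lborel"
    let ?B = "box (- (real m *\<^sub>R One)) (real m *\<^sub>R One) :: 'a set"
    have A: "A \<in> sigma_sets UNIV (range (\<lambda>(a, b). box a b))"
      using \<open>A \<in> sets lborel\<close> by (simp add: borel_eq_box)
    have borel: "sigma_sets UNIV (range (\<lambda>(a, b). box a b)) = sets (borel :: 'a measure)"
      by (simp add: borel_eq_box)
    have si: "set_integrable lborel C (\<lambda>x. indicator ?B x * h' x)" if "C \<in> sets borel" for C
      unfolding set_integrable_def using int' that by (intro integrable_mult_indicator) auto
    have "Int_stable (range (\<lambda>(a, b). box a b :: 'a set))"
      by (auto simp: Int_stable_def box_Int_box)
    moreover have "range (\<lambda>(a, b). box a b :: 'a set) \<subseteq> Pow UNIV" by simp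
    ultimately show "set_lebesgue_integral lborel A (\<lambda>x. indicator ?B x * h' x) = 0"
      using A
    proof (induction A rule: sigma_sets_induct_disjoint)
      case (basic C)
      then obtain a b where C: "C = box a b" by auto
      obtain c d where cd: "box a b \<inter> ?B = box c d" unfolding box_Int_box by blast
      have "indicator C x *\<^sub>R (indicator ?B x * h' x) = indicator (box c d) x * h' x" for x
        by (simp add: C cd[symmetric] indicator_inter_arith mult.assoc)
      then show ?case using zero'[of c d] unfolding set_lebesgue_integral_def by presburger
    next
      case empty
      then show ?case by (simp add: set_lebesgue_integral_def)
    next
      case (compl C)
      then have C: "C \<in> sets borel" using borel by simp
      have "set_lebesgue_integral lborel (C \<union> (UNIV - C)) (\<lambda>x. indicator ?B x * h' x)
        = set_lebesgue_integral lborel C (\<lambda>x. indicator ?B x * h' x)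
        + set_lebesgue_integral lborel (UNIV - C) (\<lambda>x. indicator ?B x * h' x)"
        by (rule set_integral_Un) (use C si in auto)
      moreover have "set_lebesgue_integral lborel (C \<union> (UNIV - C)) (\<lambda>x. indicator ?B x * h' x) = 0"
        using zero' by (simp add: set_lebesgue_integral_def)
      ultimately show ?case using compl by simp
    next
      case (union C)
      then have C: "range C \<subseteq> sets borel" using borel by simp
      have "(\<Union>i. C i) \<in> sets borel" using C by auto
      then have "set_lebesgue_integral lborel (\<Union>i. C i) (\<lambda>x. indicator ?B x * h' x)
         = (\<Sum>i. set_lebesgue_integral lborel (C i) (\<lambda>x. indicator ?B x * h' x))"
        using C union.hyps(1)
        by (intro lebesgue_integral_countable_add si) (auto simp: disjoint_family_on_def)
      then show ?case using union by simp
    qed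
  qed
  then have "AE x in lborel. \<forall>m. indicator (box (- (real m *\<^sub>R One)) (real m *\<^sub>R One)) x * h' x = 0"
    unfolding AE_all_countable by blast
  then have "AE x in lborel. h' x = 0"
  proof eventually_elim
    case (elim x)
    have "x \<in> (\<Union>m. box (- (real m *\<^sub>R One)) (real m *\<^sub>R One))" by (simp add: UN_box_eq_UNIV)
    then show ?case using elim by (fastforce simp: indicator_def)
  qed
  then have "AE x in lborel. h x = 0" using eq by eventually_elim simp
  then show ?thesis by (rule AE_completion)
qed

lemma integrable_indicator_box_times_component:
  fixes G :: "real^'n \<Rightarrow> real^'n"
  assumes "G \<in> L2_fields"
  shows "integrable lebesgue (\<lambda>x. indicator (box a b) x * G x $ i)"
proof -
  have "(\<lambda>x. indicator (box a b) x *\<^sub>R (axis i 1 :: real^'n)) \<in> L2_fields"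
  proof -
    have "box a b \<in> lmeasurable" by (rule lmeasurable_box)
    then have "integrable lebesgue (indicator (box a b) :: real^'n \<Rightarrow> real)"
      by (simp add: fmeasurable_def)
    moreover have "(norm (indicator (box a b) x *\<^sub>R (axis i 1 :: real^'n)))\<^sup>2 = indicator (box a b) x" for x
      by (simp add: indicator_def)
    ultimately show ?thesis
      by (auto simp: L2_fields_def intro!: borel_measurable_scaleR borel_measurable_indicator)
  qed
  from integrable_inner_L2_fields[OF assms this] show ?thesis
    by (simp add: inner_axis mult.commute)
qed

text \<open>Testing the difference of two gradients against bumps that converge to the indicator of a box
shows, by dominated convergence, that it integrates to \<open>0\<close> over every box.\<close>

lemma distr_gradient_unique:
  fixes u :: "real^'n \<Rightarrow> real"
  assumes "has_distr_gradient u G" "G \<in> L2_fields" "has_distr_gradient u H" "H \<in> L2_fields"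
  shows "AE x in lebesgue. G x = H x"
proof -
  have "AE x in lebesgue. G x $ i - H x $ i = 0" for i
  proof (rule AE_eq_0_of_box_integrals)
    show "(\<lambda>x. G x $ i - H x $ i) \<in> borel_measurable lebesgue"
      using assms by (intro borel_measurable_diff measurable_component L2_fields_measurable)
    fix a b :: "real^'n"
    show int: "integrable lebesgue (\<lambda>x. indicator (box a b) x * (G x $ i - H x $ i))"
      unfolding right_diff_distrib
      using assms by (intro Bochner_Integration.integrable_diff integrable_indicator_box_times_component)
    have "(\<lambda>k. LINT x|lebesgue. box_bump a b k x * (G x $ i - H x $ i))
        \<longlonglongrightarrow> (LINT x|lebesgue. indicator (box a b) x * (G x $ i - H x $ i))"
    proof (rule integral_dominated_convergence)
      show "integrable lebesgue (\<lambda>x. norm (indicator (box a b) x * (G x $ i - H x $ i)))"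
        using int by (rule integrable_norm)
      show "(\<lambda>x. box_bump a b k x * (G x $ i - H x $ i)) \<in> borel_measurable lebesgue" for k
        using assms by (intro borel_measurable_times borel_measurable_diff measurable_component
            L2_fields_measurable lebesgue_measurable_continuous test_functionD(3)[OF test_function_box_bump])
      show "(\<lambda>x. indicator (box a b) x * (G x $ i - H x $ i)) \<in> borel_measurable lebesgue"
        using int by (rule borel_measurable_integrable)
      show "AE x in lebesgue. (\<lambda>k. box_bump a b k x * (G x $ i - H x $ i))
          \<longlonglongrightarrow> indicator (box a b) x * (G x $ i - H x $ i)"
        by (intro AE_I2 tendsto_mult box_bump_tendsto tendsto_const)
      show "AE x in lebesgue. norm (box_bump a b k x * (G x $ i - H x $ i))
          \<le> norm (indicator (box a b) x * (G x $ i - H x $ i))" for k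
      proof (intro AE_I2)
        fix x
        show "norm (box_bump a b k x * (G x $ i - H x $ i)) \<le> norm (indicator (box a b) x * (G x $ i - H x $ i))"
          using box_bump_bounds[of a b k x] box_bump_eq_0[of x a b k]
          by (cases "x \<in> box a b") (auto simp: abs_mult intro!: mult_left_le_one_le)
      qed
    qed
    moreover have "(LINT x|lebesgue. box_bump a b k x * (G x $ i - H x $ i)) = 0" for k
    proof -
      note t = test_function_box_bump[of a b k]
      have "(LINT x|lebesgue. box_bump a b k x * (G x $ i - H x $ i))
        = (LINT x|lebesgue. G x $ i * box_bump a b k x - H x $ i * box_bump a b k x)"
        by (simp add: algebra_simps)
      also have "\<dots> = (LINT x|lebesgue. G x $ i * box_bump a b k x) - (LINT x|lebesgue. H x $ i * box_bump a b k x)"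
        using assms t by (intro Bochner_Integration.integral_diff integrable_component_times_test_function)
      also have "\<dots> = 0"
        using assms(1)[unfolded has_distr_gradient_def, rule_format, OF t, of i]
          assms(3)[unfolded has_distr_gradient_def, rule_format, OF t, of i] by linarith
      finally show ?thesis .
    qed
    ultimately show "(LINT x|lebesgue. indicator (box a b) x * (G x $ i - H x $ i)) = 0"
      by (simp add: LIMSEQ_const_iff)
  qed
  then have "AE x in lebesgue. \<forall>i\<in>UNIV. G x $ i - H x $ i = 0"
    by (subst AE_finite_all) auto
  then show ?thesis by eventually_elim (simp add: vec_eq_iff)
qed

lemma distr_gradient_L2_fields:
  assumes "u \<in> W12"
  shows "distr_gradient u \<in> L2_fields" "has_distr_gradient u (distr_gradient u)"
  using someI_ex[of "\<lambda>G. G \<in> L2_fields \<and> has_distr_gradient u G"] assms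
  unfolding distr_gradient_def W12_def by auto

text \<open>The Dirichlet energy may be computed with any square integrable gradient, not only with the one
selected by \<^const>\<open>distr_gradient\<close>.\<close>

lemma integral_norm_distr_gradient_eq:
  fixes u :: "real^'n \<Rightarrow> real"
  assumes "has_distr_gradient u G" "G \<in> L2_fields" "u \<in> W12"
  shows "(LINT x|lebesgue. (norm (distr_gradient u x))\<^sup>2) = (LINT x|lebesgue. (norm (G x))\<^sup>2)"
proof (rule integral_cong_AE)
  note d = distr_gradient_L2_fields[OF assms(3)]
  show "AE x in lebesgue. (norm (distr_gradient u x))\<^sup>2 = (norm (G x))\<^sup>2"
    using distr_gradient_unique[OF d(2,1) assms(1,2)] by eventually_elim simp
  show "(\<lambda>x. (norm (distr_gradient u x))\<^sup>2) \<in> borel_measurable lebesgue"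
    "(\<lambda>x. (norm (G x))\<^sup>2) \<in> borel_measurable lebesgue"
    using d(1) assms(2) by (auto simp: L2_fields_def)
qed

section \<open>Replacing the first function of a minimizer\<close>

lemma minimizer_compare_first:
  fixes u :: "nat \<Rightarrow> real^'n \<Rightarrow> real"
  assumes N: "N \<ge> 1" and min: "is_minimizer N \<Omega> f g F u W"
    and adm: "(u(1 := v), W') \<in> admissible_pairs N \<Omega>"
    and G: "has_distr_gradient (u 1) G" "G \<in> L2_fields"
    and H: "has_distr_gradient v H" "H \<in> L2_fields"
  shows "(LINT x|lebesgue. (norm (G x))\<^sup>2) + (LINT x|lebesgue_on \<Omega>. (u 1 x)\<^sup>2 * f 1 x - u 1 x * g 1 x) + F W
    \<le> (LINT x|lebesgue. (norm (H x))\<^sup>2) + (LINT x|lebesgue_on \<Omega>. (v x)\<^sup>2 * f 1 x - v x * g 1 x) + F W'"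
proof -
  have split: "(\<Sum>i=1..N. h i) = h 1 + (\<Sum>i=2..N. h i)" for h :: "nat \<Rightarrow> real"
    using N by (simp add: sum.atLeast_Suc_atMost numeral_2_eq_2)
  have adm0: "(u, W) \<in> admissible_pairs N \<Omega>"
    using min by (simp add: is_minimizer_def)
  have "u 1 \<in> W12" "v \<in> W12"
    using adm0 adm N by (auto simp: admissible_pairs_def PiE_iff Ball_def split: if_splits)
  note E = integral_norm_distr_gradient_eq[OF G \<open>u 1 \<in> W12\<close>] integral_norm_distr_gradient_eq[OF H \<open>v \<in> W12\<close>]
  have "J_functional N \<Omega> f g F u W \<le> J_functional N \<Omega> f g F (u(1 := v)) W'"
    using min adm by (auto simp: is_minimizer_def)
  moreover have
    "(\<Sum>i=2..N. LINT x|lebesgue. (norm (distr_gradient ((u(1 := v)) i) x))\<^sup>2)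
      = (\<Sum>i=2..N. LINT x|lebesgue. (norm (distr_gradient (u i) x))\<^sup>2)"
    "(\<Sum>i=2..N. LINT x|lebesgue_on \<Omega>. ((u(1 := v)) i x)\<^sup>2 * f i x - (u(1 := v)) i x * g i x)
      = (\<Sum>i=2..N. LINT x|lebesgue_on \<Omega>. (u i x)\<^sup>2 * f i x - u i x * g i x)"
    by (intro sum.cong; simp)+
  ultimately show ?thesis
    unfolding J_functional_def split fun_upd_same E by linarith
qed

lemma gradient_eq: "(f has_derivative f') (at x) \<Longrightarrow> gradient f x = (\<chi> i. f' (axis i 1))"
  unfolding gradient_def by (drule frechet_derivative_at) simp

section \<open>Removing a ball\<close>

text \<open>A smooth function that is \<open>1\<close> on \<open>ball x s\<close> and \<open>0\<close> off \<open>ball x (2 * s)\<close>, obtained without dividing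
two bumps: with \<open>q = |y - x|\<^sup>2 / s\<^sup>2\<close>, the inner flat function is \<open>0\<close> for \<open>q \<le> 1\<close> and at least
\<open>flat 0 3\<close> for \<open>q \<ge> 4\<close>, so the outer argument is the constant \<open>flat 0 3\<close> in the first region and
nonpositive in the second.\<close>

definition cutoff :: "real^'n \<Rightarrow> real \<Rightarrow> real^'n \<Rightarrow> real" where
  "cutoff x s y = flat 0 (flat 0 3 - flat 0 (((y - x) \<bullet> (y - x)) / s\<^sup>2 - 1)) / flat 0 (flat 0 3)"

text \<open>A bound for the gradient of the cutoff at scale \<open>s = 1\<close>: the two derivatives of the flat function are at most \<open>2\<close>
each, and the gradient of \<open>q\<close> has norm at most \<open>4 / s\<close> on \<open>cball x (2 * s)\<close>.\<close>

definition cutoff_lip :: real where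
  "cutoff_lip = 16 / flat 0 (flat 0 3)"

lemma flat_0_mono: "a \<le> b \<Longrightarrow> flat 0 a \<le> flat 0 b"
  by (auto simp: flat_0 frac_le)

lemma flat_0_pos: "t > 0 \<Longrightarrow> flat 0 t > 0"
  by (simp add: flat_0)

lemma cutoff_bounds: "0 \<le> cutoff x s y" "cutoff x s y \<le> 1"
proof -
  have pos: "flat 0 (flat 0 3) > 0" by (intro flat_0_pos) simp
  show "0 \<le> cutoff x s y" by (simp add: cutoff_def flat_0_bounds)
  have "flat 0 (flat 0 3 - flat 0 (((y - x) \<bullet> (y - x)) / s\<^sup>2 - 1)) \<le> flat 0 (flat 0 3)"
    by (rule flat_0_mono) (simp add: flat_0_bounds)
  then show "cutoff x s y \<le> 1" using pos by (simp add: cutoff_def)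
qed

lemma inner_self_diff_eq_dist: "(y - x) \<bullet> (y - x) = (dist x y)\<^sup>2"
  by (metis dist_commute dist_norm power2_norm_eq_inner)

lemma cutoff_eq_1:
  assumes "s > 0" "y \<in> ball x s" shows "cutoff x s y = 1"
proof -
  have "(dist x y)\<^sup>2 \<le> s\<^sup>2" using assms by (intro power_mono) auto
  then have "((y - x) \<bullet> (y - x)) / s\<^sup>2 - 1 \<le> 0" using assms by (simp add: inner_self_diff_eq_dist)
  moreover have "flat 0 (flat 0 3) > 0" by (intro flat_0_pos) simp
  ultimately show ?thesis by (simp add: cutoff_def flat_nonpos)
qed

lemma cutoff_arg_ge_3:
  assumes "s > 0" "y \<notin> ball x (2 * s)" shows "((y - x) \<bullet> (y - x)) / s\<^sup>2 - 1 \<ge> 3"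
proof -
  have "(2 * s)\<^sup>2 \<le> (dist x y)\<^sup>2" using assms by (intro power_mono) auto
  then show ?thesis using assms by (simp add: inner_self_diff_eq_dist field_simps power2_eq_square)
qed

lemma cutoff_eq_0:
  assumes "s > 0" "y \<notin> ball x (2 * s)" shows "cutoff x s y = 0"
  using flat_0_mono[OF cutoff_arg_ge_3[OF assms]] by (simp add: cutoff_def flat_nonpos)

lemma cont_diff_cutoff: "cont_diff k (cutoff x s)"
proof -
  have "cutoff x s = (\<lambda>y. (1 / flat 0 (flat 0 3)) *
    flat 0 (flat 0 3 + (-1) * flat 0 ((1 / s\<^sup>2) * ((y - x) \<bullet> (y - x)) + (-1))))"
    by (simp add: cutoff_def fun_eq_iff)
  then show ?thesis
    by (simp only:) (intro cont_diff_mult cont_diff_add cont_diff_flat cont_diff_const cont_diff_sqnorm)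
qed

lemma norm_gradient_cutoff_le:
  assumes s: "s > 0"
  shows "norm (gradient (cutoff x s) y) \<le> (cutoff_lip / s) * indicator (cball x (2 * s)) y"
proof -
  let ?q = "((y - x) \<bullet> (y - x)) / s\<^sup>2 - 1"
  define k where "k = flat 1 (flat 0 3 - flat 0 ?q) * flat 1 ?q / flat 0 (flat 0 3)"
  have pos: "flat 0 (flat 0 3) > 0" by (intro flat_0_pos) simp
  note D = flat_has_real_derivative[unfolded has_field_derivative_def]
  have "((\<lambda>y. ((y - x) \<bullet> (y - x)) / s\<^sup>2 - 1) has_derivative (\<lambda>v. 2 * ((y - x) \<bullet> v) / s\<^sup>2)) (at y)"
  proof -
    have "((\<lambda>y. (y - x) \<bullet> (y - x)) has_derivative (\<lambda>v. 2 * ((y - x) \<bullet> v))) (at y)"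
      by (auto intro!: derivative_eq_intros simp: inner_commute)
    from has_derivative_diff[OF has_derivative_mult_right[OF this, of "1 / s\<^sup>2"] has_derivative_const[of 1]]
    show ?thesis by simp
  qed
  from has_derivative_compose[OF this D[of 0]]
  have "((\<lambda>y. flat 0 3 - flat 0 (((y - x) \<bullet> (y - x)) / s\<^sup>2 - 1)) has_derivative
      (\<lambda>v. - (flat 1 ?q * (2 * ((y - x) \<bullet> v) / s\<^sup>2)))) (at y)"
    by (auto intro!: derivative_eq_intros)
  from has_derivative_compose[OF this D[of 0]]
  have "(cutoff x s has_derivative
      (\<lambda>v. flat 1 (flat 0 3 - flat 0 ?q) * (- (flat 1 ?q * (2 * ((y - x) \<bullet> v) / s\<^sup>2))) / flat 0 (flat 0 3))) (at y)"
    unfolding cutoff_def[abs_def] using pos by (auto intro!: derivative_eq_intros)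
  from gradient_eq[OF this]
  have grad: "gradient (cutoff x s) y = (- (2 / s\<^sup>2) * k) *\<^sub>R (y - x)"
    by (simp add: vec_eq_iff inner_axis k_def)
  show ?thesis
  proof (cases "y \<in> cball x (2 * s)")
    case True
    have k: "\<bar>k\<bar> \<le> 4 / flat 0 (flat 0 3)"
      using pos mult_mono[OF flat_1_bounds(2) flat_1_bounds(2), of "flat 0 3 - flat 0 ?q" ?q] flat_1_bounds(1)
      by (simp add: k_def abs_mult divide_right_mono mult.commute)
    have "norm (gradient (cutoff x s) y) = (2 / s\<^sup>2) * \<bar>k\<bar> * norm (y - x)"
      by (simp add: grad abs_mult)
    also have "\<dots> \<le> (2 / s\<^sup>2) * (4 / flat 0 (flat 0 3)) * (2 * s)"
      using True pos s by (intro mult_mono k) (auto simp: dist_norm norm_minus_commute)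
    also have "\<dots> = cutoff_lip / s"
      using s by (simp add: cutoff_lip_def power2_eq_square)
    finally show ?thesis using True by simp
  next
    case False
    then have "3 \<le> ?q" using s by (intro cutoff_arg_ge_3) auto
    then have "flat 0 3 - flat 0 ?q \<le> 0" using flat_0_mono by simp
    then have "k = 0" by (simp add: k_def flat_nonpos)
    then show ?thesis using False by (simp add: grad)
  qed
qed

text \<open>With \<open>a\<close> the gradient of \<open>u\<close>, \<open>d\<close> that of the cutoff \<open>c\<close> and \<open>w = u\<close>, the vector on the left is the
gradient of \<open>(1 - c\<^sup>2) * u\<close>.  The factor \<open>1 - c\<^sup>2\<close> instead of \<open>1 - c\<close> is what makes this work: the
mixed term carries a factor \<open>c\<close>, so \<open>4 * (c * |a|) * |w * d| \<le> c\<^sup>2 * |a|\<^sup>2 + 4 * |w * d|\<^sup>2\<close>, and the energy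
lost through the multiplier pays for \<open>c\<^sup>2 * |a|\<^sup>2\<close>.\<close>

lemma norm_cutoff_combination_le:
  fixes a d :: "'a::real_normed_vector"
  assumes c: "0 \<le> c" "c \<le> 1"
  shows "(norm ((1 - c\<^sup>2) *\<^sub>R a - (2 * c * w) *\<^sub>R d))\<^sup>2 \<le> (norm a)\<^sup>2 + 8 * w\<^sup>2 * (norm d)\<^sup>2"
proof -
  define b where "b = \<bar>w\<bar> * norm d"
  have c2: "0 \<le> 1 - c\<^sup>2" "1 - c\<^sup>2 \<le> 1" using c by (auto simp: power_le_one)
  have "norm ((1 - c\<^sup>2) *\<^sub>R a - (2 * c * w) *\<^sub>R d) \<le> (1 - c\<^sup>2) * norm a + 2 * c * b"
    using norm_triangle_ineq4[of "(1 - c\<^sup>2) *\<^sub>R a" "(2 * c * w) *\<^sub>R d"] c c2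
    by (simp add: abs_mult b_def mult.assoc)
  then have "(norm ((1 - c\<^sup>2) *\<^sub>R a - (2 * c * w) *\<^sub>R d))\<^sup>2 \<le> ((1 - c\<^sup>2) * norm a + 2 * c * b)\<^sup>2"
    by (intro power_mono) auto
  also have "\<dots> = (1 - c\<^sup>2) * ((1 - c\<^sup>2) * (norm a)\<^sup>2 + 4 * (c * norm a) * b) + 4 * c\<^sup>2 * b\<^sup>2"
    by (simp add: power2_eq_square algebra_simps)
  also have "\<dots> \<le> (1 - c\<^sup>2) * ((1 - c\<^sup>2) * (norm a)\<^sup>2 + (c * norm a)\<^sup>2 + 4 * b\<^sup>2) + 4 * c\<^sup>2 * b\<^sup>2"
  proof -
    have "4 * (c * norm a) * b \<le> (c * norm a)\<^sup>2 + 4 * b\<^sup>2"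
      using sum_squares_bound[of "c * norm a" "2 * b"] by (simp only: power_mult_distrib) simp
    then have "(1 - c\<^sup>2) * (norm a)\<^sup>2 + 4 * (c * norm a) * b \<le> (1 - c\<^sup>2) * (norm a)\<^sup>2 + (c * norm a)\<^sup>2 + 4 * b\<^sup>2"
      by linarith
    from mult_left_mono[OF this c2(1)] show ?thesis by linarith
  qed
  also have "\<dots> = (1 - c\<^sup>2) * ((norm a)\<^sup>2 + 4 * b\<^sup>2) + 4 * c\<^sup>2 * b\<^sup>2"
    by (simp add: power2_eq_square algebra_simps)
  also have "\<dots> \<le> 1 * ((norm a)\<^sup>2 + 4 * b\<^sup>2) + 4 * 1 * b\<^sup>2"
    using c c2 by (intro add_mono mult_right_mono) (auto simp: power_le_one)
  finally show ?thesis by (simp add: b_def power_mult_distrib)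
qed

lemma measure_Int_nonzero_support:
  fixes v :: "'a::euclidean_space \<Rightarrow> real"
  assumes ae: "AE y in lebesgue. y \<notin> S \<longrightarrow> v y = 0" and S: "S \<in> sets borel" and B: "B \<in> sets borel"
    and pos: "\<And>y. y \<in> B \<Longrightarrow> v y > 0"
  shows "measure lebesgue (S \<inter> B) = measure lebesgue B"
proof (rule measure_eq_AE)
  show "AE y in lebesgue. y \<in> S \<inter> B \<longleftrightarrow> y \<in> B"
    using ae by eventually_elim (use pos in force)
qed (use S B in auto)

lemma L2_fields_gradient_of_product:
  fixes u \<theta> :: "real^'n \<Rightarrow> real"
  assumes "continuous_on UNIV u" "G \<in> L2_fields" "\<And>k. cont_diff k \<theta>"
    "\<And>y. \<bar>\<theta> y\<bar> \<le> 1" "bounded {y. gradient \<theta> y \<noteq> 0}"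
  shows "(\<lambda>y. \<theta> y *\<^sub>R G y + u y *\<^sub>R gradient \<theta> y) \<in> L2_fields"
proof (intro L2_fields_add L2_fields_scale[OF assms(2), of _ 1])
  show "\<theta> \<in> borel_measurable lebesgue"
    by (intro lebesgue_measurable_continuous cont_diff_imp_continuous assms(3))
  show "(\<lambda>y. u y *\<^sub>R gradient \<theta> y) \<in> L2_fields"
    by (rule L2_fields_continuous_bounded_support)
       (auto intro!: continuous_intros assms(1) cont_diff_imp_continuous_gradient[OF assms(3)]
         bounded_subset[OF assms(5)])
qed (rule assms(4))

lemma integrable_continuous_on_cball:
  fixes h :: "real^'n \<Rightarrow> real"
  assumes "continuous_on UNIV h"
  shows "integrable lebesgue (\<lambda>y. indicator (cball x r) y * h y)"
  using borel_integrable_compact[OF compact_cball, of x r h] continuous_on_subset[OF assms]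
  by (simp add: integrable_completion borel_measurable_integrable)

lemma lower_order_change_le:
  fixes v w k :: "real^'n \<Rightarrow> real"
  assumes \<Omega>: "\<Omega> \<in> sets borel"
    and int: "integrable (lebesgue_on \<Omega>) (\<lambda>x. (v x)\<^sup>2 * f x - v x * g x)"
      "integrable (lebesgue_on \<Omega>) (\<lambda>x. (w x)\<^sup>2 * f x - w x * g x)"
    and k: "integrable lebesgue k" "\<And>y. y \<notin> \<Omega> \<Longrightarrow> k y = 0"
    and le: "AE y in lebesgue_on \<Omega>. (w y)\<^sup>2 * f y - w y * g y \<le> (v y)\<^sup>2 * f y - v y * g y + k y"
  shows "(LINT x|lebesgue_on \<Omega>. (w x)\<^sup>2 * f x - w x * g x)
    \<le> (LINT x|lebesgue_on \<Omega>. (v x)\<^sup>2 * f x - v x * g x) + (LINT x|lebesgue. k x)"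
proof -
  have ind: "(\<lambda>x. indicator \<Omega> x *\<^sub>R k x) = k"
    using k(2) by (auto simp: fun_eq_iff indicator_def)
  have k_on: "integrable (lebesgue_on \<Omega>) k"
    by (subst integrable_restrict_space) (use \<Omega> k(1) ind in auto)
  have "(LINT x|lebesgue_on \<Omega>. (w x)\<^sup>2 * f x - w x * g x)
      \<le> (LINT x|lebesgue_on \<Omega>. ((v x)\<^sup>2 * f x - v x * g x) + k x)"
    by (rule integral_mono_AE[OF int(2) Bochner_Integration.integrable_add[OF int(1) k_on] le])
  also have "\<dots> = (LINT x|lebesgue_on \<Omega>. (v x)\<^sup>2 * f x - v x * g x) + (LINT x|lebesgue_on \<Omega>. k x)"
    by (rule Bochner_Integration.integral_add[OF int(1) k_on])
  also have "(LINT x|lebesgue_on \<Omega>. k x) = (LINT x|lebesgue. k x)"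
    by (subst integral_restrict_space) (use \<Omega> ind in auto)
  finally show ?thesis .
qed

text \<open>The competitor is \<open>(1 - \<chi>\<^sup>2) * u 1\<close>, where \<open>\<chi>\<close> is the cutoff; it vanishes on \<open>A = W 1 \<inter> ball x s\<close>.
The set \<open>A\<close> is divided among the other indices as nondegeneracy prescribes.  It has the full
measure of the ball, since \<open>u 1\<close> is positive there and vanishes almost everywhere off \<open>W 1\<close>.\<close>

lemma removing_ball_energy_bound:
  fixes u :: "nat \<Rightarrow> real^'n \<Rightarrow> real"
  assumes N: "N \<ge> 1" and \<Omega>: "\<Omega> \<in> sets borel"
    and conv: "J_integrals_converge N \<Omega> f g" and min: "is_minimizer N \<Omega> f g F u W"
    and cont: "continuous_on UNIV (u 1)"
    and f: "AE y in lebesgue_on \<Omega>. \<bar>f 1 y\<bar> \<le> Mf" and g: "AE y in lebesgue_on \<Omega>. \<bar>g 1 y\<bar> \<le> Mg"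
    and nondeg: "nondegenerate N F W lam \<epsilon>"
    and s: "s > 0" "measure lebesgue (ball x s) \<le> \<epsilon>"
    and pos: "cball x (2 * s) \<subseteq> \<Omega>" "\<And>y. y \<in> cball x (2 * s) \<Longrightarrow> u 1 y > 0"
  shows "lam * measure lebesgue (ball x s)
    \<le> (LINT y|lebesgue. indicator (cball x (2 * s)) y * (8 * (u 1 y)\<^sup>2 * (cutoff_lip / s)\<^sup>2))
     + (LINT y|lebesgue. indicator (cball x (2 * s)) y * (Mf * (u 1 y)\<^sup>2 + Mg * u 1 y))"
proof -
  have adm0: "(u, W) \<in> admissible_pairs N \<Omega>" using min by (simp add: is_minimizer_def)
  then have W: "W \<in> admissible_sets N \<Omega>" and uW12: "u \<in> {1..N} \<rightarrow>\<^sub>E W12"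
    and uz: "\<And>i. i \<in> {1..N} \<Longrightarrow> AE y in lebesgue. y \<notin> W i \<longrightarrow> u i y = 0"
    by (auto simp: admissible_pairs_def)
  have Wb: "W i \<in> sets borel" "W i \<subseteq> \<Omega>" if "i \<in> {1..N}" for i
    using W that by (auto simp: admissible_sets_def PiE_iff)
  have Wdisj: "disjoint_family_on W {1..N}" using W by (simp add: admissible_sets_def)
  have one: "1 \<in> {1..N}" using N by simp
  have u1: "u 1 \<in> W12" using uW12 one by auto
  then obtain G where G: "has_distr_gradient (u 1) G" "G \<in> L2_fields" by (auto simp: W12_def)
  define A where "A = W 1 \<inter> ball x s"
  have A: "A \<in> sets borel" "A \<subseteq> W 1" using Wb(1)[OF one] by (auto simp: A_def)
  have mA: "measure lebesgue A = measure lebesgue (ball x s)"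
    unfolding A_def
    by (rule measure_Int_nonzero_support[OF uz[OF one] Wb(1)[OF one]]) (use pos(2) s(1) in auto)
  have "measure lebesgue (ball x s) > 0" using s(1) by (simp add: content_ball_pos)
  then have "0 < measure lebesgue A" "measure lebesgue A \<le> \<epsilon>" using s(2) mA by auto
  from nondeg[unfolded nondegenerate_def, rule_format, OF A this, unfolded mA]
  obtain B where B: "\<And>j. j \<in> {2..N} \<Longrightarrow> B j \<in> sets borel \<and> B j \<subseteq> A"
    and Bdisj: "disjoint_family_on B {2..N}"
    and FB: "F (\<lambda>i\<in>{1..N}. if i = 1 then W 1 - A else W i \<union> B i) \<le> F W - lam * measure lebesgue (ball x s)"
    by blast
  define W' where "W' = (\<lambda>i\<in>{1..N}. if i = 1 then W 1 - A else W i \<union> B i)"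
  define \<theta> where "\<theta> y = 1 + (-1) * (cutoff x s y * cutoff x s y)" for y
  define v where "v y = \<theta> y * u 1 y" for y
  define H where "H y = \<theta> y *\<^sub>R G y + u 1 y *\<^sub>R gradient \<theta> y" for y
  have \<theta>_smooth: "cont_diff k \<theta>" for k
    unfolding \<theta>_def[abs_def] by (intro cont_diff_add cont_diff_mult cont_diff_const cont_diff_cutoff)
  have \<theta>_bounds: "0 \<le> \<theta> y" "\<theta> y \<le> 1" for y
    using cutoff_bounds[of x s y] by (auto simp: \<theta>_def mult_le_one)
  have \<theta>_grad: "gradient \<theta> y = - (2 * cutoff x s y) *\<^sub>R gradient (cutoff x s) y" for y
  proof -
    note c = cont_diff_SucE(1)[OF cont_diff_cutoff[of "Suc 0" x s], of y]
    have "(\<theta> has_derivative (\<lambda>v. - (2 * cutoff x s y) * frechet_derivative (cutoff x s) (at y) v)) (at y)"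
      unfolding \<theta>_def[abs_def] by (rule derivative_eq_intros c refl)+ (simp add: fun_eq_iff)
    from gradient_eq[OF this] show ?thesis
      by (simp add: gradient_def vec_eq_iff)
  qed
  have grad_out: "gradient \<theta> y = 0" if "y \<notin> cball x (2 * s)" for y
    using norm_gradient_cutoff_le[OF s(1), of x y] that by (simp add: \<theta>_grad)
  have H: "H \<in> L2_fields" "has_distr_gradient v H"
  proof -
    have "{y. gradient \<theta> y \<noteq> 0} \<subseteq> cball x (2 * s)" using grad_out by blast
    then have "bounded {y. gradient \<theta> y \<noteq> 0}" by (rule bounded_subset[OF bounded_cball])
    then show "H \<in> L2_fields" unfolding H_def[abs_def]
      by (intro L2_fields_gradient_of_product[OF cont G(2) \<theta>_smooth]) (simp_all add: abs_of_nonneg \<theta>_bounds)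
    show "has_distr_gradient v H" unfolding H_def[abs_def] v_def[abs_def]
      by (rule has_distr_gradient_mult[OF G(1) cont G(2) \<theta>_smooth])
  qed
  have v_cont: "continuous_on UNIV v"
    unfolding v_def[abs_def] by (intro continuous_intros cont cont_diff_imp_continuous[OF \<theta>_smooth])
  have adm: "(u(1 := v), W') \<in> admissible_pairs N \<Omega>"
  proof -
    have BA: "B j \<subseteq> W 1" if "j \<in> {2..N}" for j using B[OF that] A by blast
    have "W' \<in> {1..N} \<rightarrow>\<^sub>E {A \<in> sets borel. A \<subseteq> \<Omega>}"
    proof (rule PiE_I)
      fix i assume i: "i \<in> {1..N}"
      show "W' i \<in> {A \<in> sets borel. A \<subseteq> \<Omega>}"
      proof (cases "i = 1")
        case True
        then show ?thesis using i Wb[OF one] A by (auto simp: W'_def)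
      next
        case False
        then have i2: "i \<in> {2..N}" using i by auto
        have "W i \<union> B i \<in> sets borel" using Wb(1)[OF i] B[OF i2] by (intro sets.Un) auto
        moreover have "W i \<union> B i \<subseteq> \<Omega>" using Wb(2)[OF i] BA[OF i2] Wb(2)[OF one] by blast
        ultimately show ?thesis using False i by (simp add: W'_def)
      qed
    qed (auto simp: W'_def)
    moreover have "disjoint_family_on W' {1..N}"
      unfolding disjoint_family_on_def
    proof (intro ballI impI)
      have aux: "W' i \<inter> W' j = {}" if i: "i \<in> {1..N}" "i \<noteq> 1" and j: "j \<in> {1..N}" "i \<noteq> j" for i j
      proof -
        have i2: "i \<in> {2..N}" using i by auto
        have Wij: "W i \<inter> W j = {}" "W i \<inter> W 1 = {}"
          using Wdisj i j one by (auto simp: disjoint_family_on_def)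
        show ?thesis
        proof (cases "j = 1")
          case True
          then show ?thesis using Wij B[OF i2] i j by (auto simp: W'_def)
        next
          case False
          then have j2: "j \<in> {2..N}" using j by auto
          have "B i \<inter> B j = {}" "W j \<inter> W 1 = {}"
            using Bdisj Wdisj i2 j2 j one False by (auto simp: disjoint_family_on_def)
          then show ?thesis using Wij BA[OF i2] BA[OF j2] i j False by (auto simp: W'_def)
        qed
      qed
      fix i j assume "i \<in> {1..N}" "j \<in> {1..N}" "i \<noteq> j"
      then show "W' i \<inter> W' j = {}" using aux[of i j] aux[of j i] by (cases "i = 1") auto
    qed
    moreover have "u(1 := v) \<in> {1..N} \<rightarrow>\<^sub>E W12"
      using uW12 one W12_continuousI[OF v_cont H] by (auto simp: PiE_iff extensional_def)
    moreover have "AE y in lebesgue. y \<notin> W' i \<longrightarrow> (u(1 := v)) i y = 0" if i: "i \<in> {1..N}" for i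
      using uz[OF i]
    proof eventually_elim
      case (elim y)
      show ?case
      proof (cases "i = 1")
        case True
        have "v y = 0" if "y \<in> A"
          using that s(1) by (simp add: A_def v_def \<theta>_def cutoff_eq_1)
        then show ?thesis using True elim i by (auto simp: W'_def v_def)
      next
        case False
        then show ?thesis using elim i by (auto simp: W'_def)
      qed
    qed
    ultimately show ?thesis
      by (auto simp: admissible_pairs_def admissible_sets_def)
  qed
  have energy: "(LINT y|lebesgue. (norm (H y))\<^sup>2) \<le> (LINT y|lebesgue. (norm (G y))\<^sup>2)
      + (LINT y|lebesgue. indicator (cball x (2 * s)) y * (8 * (u 1 y)\<^sup>2 * (cutoff_lip / s)\<^sup>2))"
  proof -
    have intG: "integrable lebesgue (\<lambda>y. (norm (G y))\<^sup>2)" and intH: "integrable lebesgue (\<lambda>y. (norm (H y))\<^sup>2)"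
      using G(2) H(1) by (auto simp: L2_fields_def)
    have intU: "integrable lebesgue (\<lambda>y. indicator (cball x (2 * s)) y * (8 * (u 1 y)\<^sup>2 * (cutoff_lip / s)\<^sup>2))"
      by (intro integrable_continuous_on_cball continuous_intros cont)
    have pw: "(norm (H y))\<^sup>2 \<le> (norm (G y))\<^sup>2 + indicator (cball x (2 * s)) y * (8 * (u 1 y)\<^sup>2 * (cutoff_lip / s)\<^sup>2)" for y
    proof -
      let ?d = "gradient (cutoff x s) y"
      have "H y = (1 - (cutoff x s y)\<^sup>2) *\<^sub>R G y - (2 * cutoff x s y * u 1 y) *\<^sub>R ?d"
        by (simp add: H_def \<theta>_grad \<theta>_def power2_eq_square mult.commute)
      then have "(norm (H y))\<^sup>2 \<le> (norm (G y))\<^sup>2 + 8 * (u 1 y)\<^sup>2 * (norm ?d)\<^sup>2"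
        using norm_cutoff_combination_le[OF cutoff_bounds] by simp
      also have "(norm ?d)\<^sup>2 \<le> (cutoff_lip / s * indicator (cball x (2 * s)) y)\<^sup>2"
        by (intro power_mono norm_gradient_cutoff_le s) auto
      also have "\<dots> = indicator (cball x (2 * s)) y * (cutoff_lip / s)\<^sup>2"
        by (simp add: indicator_def)
      finally show ?thesis by (simp add: mult_left_mono mult.left_commute)
    qed
    have "(LINT y|lebesgue. (norm (H y))\<^sup>2) \<le> (LINT y|lebesgue. (norm (G y))\<^sup>2
      + indicator (cball x (2 * s)) y * (8 * (u 1 y)\<^sup>2 * (cutoff_lip / s)\<^sup>2))"
      by (rule integral_mono[OF intH Bochner_Integration.integrable_add[OF intG intU] pw])
    then show ?thesis by (simp only: Bochner_Integration.integral_add[OF intG intU])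
  qed
  have lower: "(LINT y|lebesgue_on \<Omega>. (v y)\<^sup>2 * f 1 y - v y * g 1 y)
      \<le> (LINT y|lebesgue_on \<Omega>. (u 1 y)\<^sup>2 * f 1 y - u 1 y * g 1 y)
       + (LINT y|lebesgue. indicator (cball x (2 * s)) y * (Mf * (u 1 y)\<^sup>2 + Mg * u 1 y))"
  proof (rule lower_order_change_le[OF \<Omega>])
    show "integrable (lebesgue_on \<Omega>) (\<lambda>y. (u 1 y)\<^sup>2 * f 1 y - u 1 y * g 1 y)"
      using conv adm0 one unfolding J_integrals_converge_def by blast
    show "integrable (lebesgue_on \<Omega>) (\<lambda>y. (v y)\<^sup>2 * f 1 y - v y * g 1 y)"
      using bspec[OF conv[unfolded J_integrals_converge_def] adm] one by (auto dest!: bspec[where x = 1])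
    show "integrable lebesgue (\<lambda>y. indicator (cball x (2 * s)) y * (Mf * (u 1 y)\<^sup>2 + Mg * u 1 y))"
      by (intro integrable_continuous_on_cball continuous_intros cont)
    show "indicator (cball x (2 * s)) y * (Mf * (u 1 y)\<^sup>2 + Mg * u 1 y) = 0" if "y \<notin> \<Omega>" for y
      using that pos(1) by (auto simp: indicator_def)
    show "AE y in lebesgue_on \<Omega>. (v y)\<^sup>2 * f 1 y - v y * g 1 y
      \<le> (u 1 y)\<^sup>2 * f 1 y - u 1 y * g 1 y + indicator (cball x (2 * s)) y * (Mf * (u 1 y)\<^sup>2 + Mg * u 1 y)"
      using f g
    proof eventually_elim
      case (elim y)
      show ?case
      proof (cases "y \<in> cball x (2 * s)")
        case True
        then have uy: "u 1 y > 0" by (rule pos(2))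
        let ?t = "\<theta> y"
        have t2: "0 \<le> 1 - ?t\<^sup>2" "1 - ?t\<^sup>2 \<le> 1" using \<theta>_bounds[of y] by (auto simp: power_le_one)
        have "(1 - ?t\<^sup>2) * (u 1 y)\<^sup>2 * (- f 1 y) \<le> 1 * (u 1 y)\<^sup>2 * Mf"
        proof -
          have "(1 - ?t\<^sup>2) * (u 1 y)\<^sup>2 * (- f 1 y) \<le> (1 - ?t\<^sup>2) * (u 1 y)\<^sup>2 * Mf"
            using t2 elim(1) by (intro mult_left_mono) auto
          also have "\<dots> \<le> 1 * (u 1 y)\<^sup>2 * Mf"
            using t2 elim(1) by (intro mult_right_mono) auto
          finally show ?thesis .
        qed
        moreover have "(1 - ?t) * u 1 y * g 1 y \<le> 1 * u 1 y * Mg"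
        proof -
          have "(1 - ?t) * u 1 y * g 1 y \<le> (1 - ?t) * u 1 y * Mg"
            using \<theta>_bounds[of y] uy elim(2) by (intro mult_left_mono) auto
          also have "\<dots> \<le> 1 * u 1 y * Mg"
            using \<theta>_bounds[of y] uy elim(2) by (intro mult_right_mono) auto
          finally show ?thesis .
        qed
        moreover have "(v y)\<^sup>2 * f 1 y - v y * g 1 y - ((u 1 y)\<^sup>2 * f 1 y - u 1 y * g 1 y)
          = (1 - ?t\<^sup>2) * (u 1 y)\<^sup>2 * (- f 1 y) + (1 - ?t) * u 1 y * g 1 y"
          by (simp add: v_def power2_eq_square algebra_simps)
        ultimately show ?thesis using True by (simp add: mult.commute)
      next
        case False
        then have "v y = u 1 y" using s(1) by (simp add: v_def \<theta>_def cutoff_eq_0)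
        then show ?thesis using False by simp
      qed
    qed
  qed
  show ?thesis
    using minimizer_compare_first[OF N min adm G H(2,1)] energy lower FB
    unfolding W'_def[symmetric] by linarith
qed

section \<open>Minimizers are weak supersolutions\<close>

definition laplacian :: "(real^'n \<Rightarrow> real) \<Rightarrow> real^'n \<Rightarrow> real" where
  "laplacian f x =
    (\<Sum>i\<in>UNIV. frechet_derivative (\<lambda>y. frechet_derivative f (at y) (axis i 1)) (at x) (axis i 1))"

lemma integral_inner_gradient_eq_laplacian:
  fixes u \<psi> :: "real^'n \<Rightarrow> real"
  assumes G: "has_distr_gradient u G" "G \<in> L2_fields" and u: "continuous_on UNIV u" and \<psi>: "test_function \<psi>"
  shows "(LINT y|lebesgue. G y \<bullet> gradient \<psi> y) = - (LINT y|lebesgue. u y * laplacian \<psi> y)"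
proof -
  let ?D = "\<lambda>i y. frechet_derivative \<psi> (at y) (axis i 1)"
  let ?DD = "\<lambda>i y. frechet_derivative (?D i) (at y) (axis i 1)"
  note t = test_function_partial[OF \<psi>]
  have "(LINT y|lebesgue. G y \<bullet> gradient \<psi> y) = (LINT y|lebesgue. (\<Sum>i\<in>UNIV. G y $ i * ?D i y))"
    by (simp add: inner_vec_def gradient_def)
  also have "\<dots> = (\<Sum>i\<in>UNIV. LINT y|lebesgue. G y $ i * ?D i y)"
    by (intro Bochner_Integration.integral_sum integrable_component_times_test_function G t)
  also have "\<dots> = (\<Sum>i\<in>UNIV. - (LINT y|lebesgue. u y * ?DD i y))"
    using G(1) t unfolding has_distr_gradient_def by (intro sum.cong) auto
  also have "\<dots> = - (LINT y|lebesgue. (\<Sum>i\<in>UNIV. u y * ?DD i y))"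
    by (subst Bochner_Integration.integral_sum)
       (auto simp: sum_negf intro!: integrable_times_test_function u test_function_partial t)
  finally show ?thesis by (simp add: laplacian_def sum_distrib_left)
qed

text \<open>For small positive \<open>\<tau>\<close> the linear term dominates.\<close>

lemma nonneg_of_perturbation:
  fixes a q :: real
  assumes "\<And>\<tau>. \<tau> > 0 \<Longrightarrow> 0 \<le> \<tau> * a + \<tau>\<^sup>2 * q"
  shows "0 \<le> a"
proof (rule ccontr)
  assume "\<not> 0 \<le> a"
  define \<tau> where "\<tau> = - a / (2 * (\<bar>q\<bar> + 1))"
  have "\<tau> > 0" using \<open>\<not> 0 \<le> a\<close> by (simp add: \<tau>_def divide_neg_pos)
  then have "0 \<le> a + \<tau> * q"
    using assms[of \<tau>] by (simp add: power2_eq_square mult.assoc zero_le_mult_iff flip: distrib_left)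
  also have "\<dots> \<le> a + \<tau> * (\<bar>q\<bar> + 1)" using \<open>\<tau> > 0\<close> by simp
  also have "\<dots> = a / 2" unfolding \<tau>_def by (simp add: field_simps)
  finally show False using \<open>\<not> 0 \<le> a\<close> by simp
qed

text \<open>The competitor \<open>u 1 + \<tau> * \<psi>\<close> is admissible with the sets unchanged, because \<open>\<psi>\<close> vanishes almost
everywhere off \<open>W 1\<close>.  Its functional exceeds that of \<open>u 1\<close> by at most a quadratic polynomial in \<open>\<tau>\<close>
without constant term; the linear coefficient of that polynomial is nonnegative, and the term with the gradients is
turned into \<open>\<integral> u * \<Delta>\<psi>\<close> by moving the derivative back to \<open>\<psi>\<close>.\<close>

lemma minimizer_weak_supersolution:
  fixes u :: "nat \<Rightarrow> real^'n \<Rightarrow> real"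
  assumes N: "N \<ge> 1" and \<Omega>: "\<Omega> \<in> sets borel"
    and conv: "J_integrals_converge N \<Omega> f g" and min: "is_minimizer N \<Omega> f g F u W"
    and cont: "continuous_on UNIV (u 1)"
    and f: "AE y in lebesgue_on \<Omega>. \<bar>f 1 y\<bar> \<le> Mf" and g: "AE y in lebesgue_on \<Omega>. \<bar>g 1 y\<bar> \<le> Mg"
    and \<psi>: "test_function \<psi>" "\<And>y. 0 \<le> \<psi> y"
    and supp: "\<And>y. \<psi> y \<noteq> 0 \<Longrightarrow> y \<in> \<Omega> \<and> 0 < u 1 y \<and> u 1 y \<le> C"
    and K: "Mf * C + Mg / 2 \<le> K"
  shows "(LINT y|lebesgue. u 1 y * laplacian \<psi> y) \<le> K * (LINT y|lebesgue. \<psi> y)"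
proof -
  have adm0: "(u, W) \<in> admissible_pairs N \<Omega>" using min by (simp add: is_minimizer_def)
  then have W: "W \<in> admissible_sets N \<Omega>" and uW12: "u \<in> {1..N} \<rightarrow>\<^sub>E W12"
    and uz: "\<And>i. i \<in> {1..N} \<Longrightarrow> AE y in lebesgue. y \<notin> W i \<longrightarrow> u i y = 0"
    by (auto simp: admissible_pairs_def)
  have one: "1 \<in> {1..N}" using N by simp
  obtain G where G: "has_distr_gradient (u 1) G" "G \<in> L2_fields"
    using uW12 one by (force simp: W12_def)
  note \<psi>s = test_functionD[OF \<psi>(1)]
  have grad: "gradient \<psi> \<in> L2_fields"
  proof (rule L2_fields_continuous_bounded_support[OF cont_diff_imp_continuous_gradient[OF \<psi>s(1)]])
    have "{y. gradient \<psi> y \<noteq> 0} \<subseteq> closure {y. \<psi> y \<noteq> 0}"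
      using frechet_derivative_zero_off_closure[of _ \<psi>] by (auto simp: gradient_def vec_eq_iff)
    then show "bounded {y. gradient \<psi> y \<noteq> 0}"
      using bounded_closure[OF \<psi>s(2)] bounded_subset by blast
  qed
  define P where "P = (LINT y|lebesgue. \<psi> y)"
  define P2 where "P2 = (LINT y|lebesgue. (\<psi> y)\<^sup>2)"
  define I where "I = (LINT y|lebesgue. G y \<bullet> gradient \<psi> y)"
  define Q where "Q = (LINT y|lebesgue. (norm (gradient \<psi> y))\<^sup>2)"
  have int\<psi>: "integrable lebesgue \<psi>"
    by (rule integrable_continuous_bounded_support[OF \<psi>s(3,2)])
  have int\<psi>2: "integrable lebesgue (\<lambda>y. (\<psi> y)\<^sup>2)"
    using integrable_square_continuous_bounded_support[OF \<psi>s(3,2)] by simp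
  have "0 \<le> \<tau> * (2 * (I + K * P)) + \<tau>\<^sup>2 * (Q + Mf * P2)" if \<tau>: "\<tau> > 0" for \<tau>
  proof -
    define \<psi>' where "\<psi>' y = \<tau> * \<psi> y" for y
    define v where "v y = u 1 y + \<psi>' y" for y
    define H where "H y = G y + \<tau> *\<^sub>R gradient \<psi> y" for y
    have \<psi>'_smooth: "cont_diff k \<psi>'" for k
      unfolding \<psi>'_def[abs_def] by (intro cont_diff_mult cont_diff_const \<psi>s)
    have \<psi>'_grad: "gradient \<psi>' = (\<lambda>y. \<tau> *\<^sub>R gradient \<psi> y)"
    proof
      fix y
      from gradient_eq[OF has_derivative_mult_right[OF \<psi>s(4), of \<tau> y]]
      show "gradient \<psi>' y = \<tau> *\<^sub>R gradient \<psi> y"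
        by (simp add: \<psi>'_def[abs_def] gradient_def vec_eq_iff)
    qed
    have sgrad: "(\<lambda>y. \<tau> *\<^sub>R gradient \<psi> y) \<in> L2_fields"
      by (rule L2_fields_scale[OF grad]) auto
    have H: "H \<in> L2_fields" "has_distr_gradient v H"
      unfolding H_def[abs_def] v_def[abs_def]
      using L2_fields_add[OF G(2) sgrad]
        has_distr_gradient_add[OF G(1) cont G(2)
          has_distr_gradient_smooth[OF \<psi>'_smooth, unfolded \<psi>'_grad] cont_diff_imp_continuous[OF \<psi>'_smooth] sgrad]
      by simp_all
    have v_cont: "continuous_on UNIV v"
      unfolding v_def[abs_def] by (intro continuous_intros cont cont_diff_imp_continuous[OF \<psi>'_smooth])
    have "u(1 := v) \<in> {1..N} \<rightarrow>\<^sub>E W12"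
      using uW12 one W12_continuousI[OF v_cont H] by (auto simp: PiE_iff extensional_def)
    moreover have "AE y in lebesgue. y \<notin> W i \<longrightarrow> (u(1 := v)) i y = 0" if "i \<in> {1..N}" for i
      using uz[OF that]
    proof eventually_elim
      case (elim y)
      then show ?case using supp[of y] by (cases "i = 1"; cases "\<psi> y = 0") (auto simp: v_def \<psi>'_def)
    qed
    ultimately have adm: "(u(1 := v), W) \<in> admissible_pairs N \<Omega>"
      using W by (auto simp: admissible_pairs_def)
    have energy: "(LINT y|lebesgue. (norm (H y))\<^sup>2) = (LINT y|lebesgue. (norm (G y))\<^sup>2) + 2 * \<tau> * I + \<tau>\<^sup>2 * Q"
    proof -
      have "(norm (H y))\<^sup>2 = ((norm (G y))\<^sup>2 + 2 * \<tau> * (G y \<bullet> gradient \<psi> y)) + \<tau>\<^sup>2 * (norm (gradient \<psi> y))\<^sup>2" for y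
        unfolding power2_norm_eq_inner H_def
        by (simp add: inner_add_left inner_add_right inner_commute power2_eq_square)
      moreover have "integrable lebesgue (\<lambda>y. (norm (G y))\<^sup>2)" "integrable lebesgue (\<lambda>y. (norm (gradient \<psi> y))\<^sup>2)"
        using G(2) grad by (auto simp: L2_fields_def)
      ultimately show ?thesis
        using integrable_inner_L2_fields[OF G(2) grad] by (simp add: I_def Q_def)
    qed
    define k where "k y = 2 * K * \<tau> * \<psi> y + \<tau>\<^sup>2 * Mf * (\<psi> y)\<^sup>2" for y
    have int_k: "integrable lebesgue k" unfolding k_def[abs_def] using int\<psi> int\<psi>2 by simp
    have lower: "(LINT y|lebesgue_on \<Omega>. (v y)\<^sup>2 * f 1 y - v y * g 1 y)
      \<le> (LINT y|lebesgue_on \<Omega>. (u 1 y)\<^sup>2 * f 1 y - u 1 y * g 1 y) + (LINT y|lebesgue. k y)"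
    proof (rule lower_order_change_le[OF \<Omega> _ _ int_k])
      show "integrable (lebesgue_on \<Omega>) (\<lambda>y. (u 1 y)\<^sup>2 * f 1 y - u 1 y * g 1 y)"
        using conv adm0 one unfolding J_integrals_converge_def by blast
      show "integrable (lebesgue_on \<Omega>) (\<lambda>y. (v y)\<^sup>2 * f 1 y - v y * g 1 y)"
        using bspec[OF conv[unfolded J_integrals_converge_def] adm] one by (auto dest!: bspec[where x = 1])
      show "k y = 0" if "y \<notin> \<Omega>" for y
      proof -
        have "\<psi> y = 0" using that supp[of y] by blast
        then show ?thesis by (simp add: k_def)
      qed
      show "AE y in lebesgue_on \<Omega>. (v y)\<^sup>2 * f 1 y - v y * g 1 y \<le> (u 1 y)\<^sup>2 * f 1 y - u 1 y * g 1 y + k y"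
        using f g
      proof eventually_elim
        case (elim y)
        have eq: "(v y)\<^sup>2 * f 1 y - v y * g 1 y
          = (u 1 y)\<^sup>2 * f 1 y - u 1 y * g 1 y + (\<tau> * \<psi> y * (2 * u 1 y * f 1 y - g 1 y) + \<tau>\<^sup>2 * (\<psi> y)\<^sup>2 * f 1 y)"
          by (simp add: v_def \<psi>'_def power2_eq_square algebra_simps)
        show ?case
        proof (cases "\<psi> y = 0")
          case False
          then have uy: "0 < u 1 y" "u 1 y \<le> C" using supp by auto
          have "u 1 y * f 1 y \<le> u 1 y * Mf" using uy elim(1) by (intro mult_left_mono) auto
          also have "\<dots> \<le> C * Mf" using uy elim(1) by (intro mult_right_mono) auto
          finally have "2 * u 1 y * f 1 y - g 1 y \<le> 2 * K"
            using K elim(2) by (simp add: mult.commute)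
          then have "\<tau> * \<psi> y * (2 * u 1 y * f 1 y - g 1 y) \<le> \<tau> * \<psi> y * (2 * K)"
            using \<tau> \<psi>(2)[of y] by (intro mult_left_mono) auto
          moreover have "\<tau>\<^sup>2 * (\<psi> y)\<^sup>2 * f 1 y \<le> \<tau>\<^sup>2 * (\<psi> y)\<^sup>2 * Mf"
            using elim(1) by (intro mult_left_mono) auto
          ultimately show ?thesis unfolding eq k_def by (simp add: algebra_simps)
        next
          case True
          show ?thesis unfolding eq k_def by (simp add: True)
        qed
      qed
    qed
    have int_k_eq: "(LINT y|lebesgue. k y) = 2 * K * \<tau> * P + \<tau>\<^sup>2 * Mf * P2"
      unfolding k_def[abs_def] P_def P2_def using int\<psi> int\<psi>2 by simp
    have "0 \<le> 2 * \<tau> * I + \<tau>\<^sup>2 * Q + (2 * K * \<tau> * P + \<tau>\<^sup>2 * Mf * P2)"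
      using minimizer_compare_first[OF N min adm G H(2,1)] energy lower int_k_eq by linarith
    then show ?thesis by (simp add: algebra_simps)
  qed
  from nonneg_of_perturbation[OF this] have "0 \<le> I + K * P" by simp
  then show ?thesis
    using integral_inner_gradient_eq_laplacian[OF G cont \<psi>(1)] by (simp add: I_def P_def)
qed

section \<open>A mean value inequality\<close>

text \<open>The bump and the kernel below are matched: \<open>radial_kernel\<close> is a radial weight, scaled to radius \<open>t\<close>, of which
the derivative in \<open>t\<close> is \<open>t / t ^ n\<close> times the Laplacian of \<open>radial_bump\<close>.  This holds because the weight
\<open>p (z) = 2 * flat 1 (1 - |z|\<^sup>2)\<close> satisfies \<open>p (z) *\<^sub>R z = - \<nabla> (flat 0 (1 - |z|\<^sup>2))\<close>, while differentiating
\<open>t ^ (- n) * p ((y - x) / t)\<close> in \<open>t\<close> produces \<open>- t ^ (- n - 1) * div (p (z) *\<^sub>R z)\<close> at \<open>z = (y - x) / t\<close>.\<close>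

definition radial_bump :: "real^'n \<Rightarrow> real \<Rightarrow> real^'n \<Rightarrow> real" where
  "radial_bump x t y = flat 0 (1 - ((y - x) \<bullet> (y - x)) / t\<^sup>2)"

definition radial_kernel :: "real^'n \<Rightarrow> real \<Rightarrow> real^'n \<Rightarrow> real" where
  "radial_kernel x t y = 2 * flat 1 (1 - ((y - x) \<bullet> (y - x)) / t\<^sup>2) / t ^ CARD('n)"

lemma radial_arg_nonpos:
  assumes "t > 0" "y \<notin> ball x t" shows "1 - ((y - x) \<bullet> (y - x)) / t\<^sup>2 \<le> 0"
proof -
  have "t\<^sup>2 \<le> (dist x y)\<^sup>2" using assms by (intro power_mono) auto
  then show ?thesis using assms by (simp add: inner_self_diff_eq_dist)
qed

lemma radial_bump_eq_0: "t > 0 \<Longrightarrow> y \<notin> ball x t \<Longrightarrow> radial_bump x t y = 0"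
  using flat_nonpos[OF radial_arg_nonpos, of t y x 0] by (simp add: radial_bump_def)

lemma radial_kernel_eq_0: "t > 0 \<Longrightarrow> y \<notin> ball x t \<Longrightarrow> radial_kernel x t y = 0"
  using flat_nonpos[OF radial_arg_nonpos, of t y x 1] by (simp add: radial_kernel_def)

lemma radial_bump_bounds: "0 \<le> radial_bump x t y" "radial_bump x t y \<le> 1"
  by (simp_all add: radial_bump_def flat_0_bounds)

lemma test_function_radial_bump:
  assumes "t > 0" shows "test_function (radial_bump x t)"
proof (rule test_functionI)
  have "radial_bump x t = (\<lambda>y. flat 0 (1 + (- 1 / t\<^sup>2) * ((y - x) \<bullet> (y - x))))"
    by (simp add: radial_bump_def fun_eq_iff)
  then show "cont_diff k (radial_bump x t)" for k
    by (simp only:) (intro cont_diff_mult cont_diff_add cont_diff_flat cont_diff_const cont_diff_sqnorm)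
  show "bounded {y. radial_bump x t y \<noteq> 0}"
    by (rule bounded_subset[OF bounded_ball[of x t]]) (use radial_bump_eq_0[OF assms] in blast)
qed

lemma laplacian_radial_bump:
  fixes x :: "real^'n"
  shows "laplacian (radial_bump x t) y
    = 4 * ((y - x) \<bullet> (y - x)) / t ^ 4 * flat 2 (1 - ((y - x) \<bullet> (y - x)) / t\<^sup>2)
      - 2 * real CARD('n) / t\<^sup>2 * flat 1 (1 - ((y - x) \<bullet> (y - x)) / t\<^sup>2)"
proof -
  define a where "a z = 1 - ((z - x) \<bullet> (z - x)) / t\<^sup>2" for z
  note D = flat_has_real_derivative[unfolded has_field_derivative_def]
  have a: "(a has_derivative (\<lambda>v. (- 2 / t\<^sup>2) * ((z - x) \<bullet> v))) (at z)" for z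
  proof -
    have "((\<lambda>y. (y - x) \<bullet> (y - x)) has_derivative (\<lambda>v. 2 * ((z - x) \<bullet> v))) (at z)"
      by (auto intro!: derivative_eq_intros simp: inner_commute)
    from has_derivative_diff[OF has_derivative_const[of 1] has_derivative_mult_right[OF this, of "1 / t\<^sup>2"]]
    show ?thesis by (simp add: a_def[abs_def])
  qed
  have fl: "((\<lambda>z. flat j (a z)) has_derivative (\<lambda>v. flat (Suc j) (a z) * ((- 2 / t\<^sup>2) * ((z - x) \<bullet> v)))) (at z)"
    for j z using has_derivative_compose[OF a D[of j]] .
  have first: "frechet_derivative (radial_bump x t) (at z) v = (- 2 / t\<^sup>2) * (flat 1 (a z) * ((z - x) \<bullet> v))" for z v
    using fun_cong[OF frechet_derivative_at[OF fl[of 0 z], symmetric], of v]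
    by (simp add: radial_bump_def[abs_def] a_def[abs_def])
  have second: "frechet_derivative (\<lambda>z. frechet_derivative (radial_bump x t) (at z) v) (at y) v
     = (- 2 / t\<^sup>2) * (flat 1 (a y) * (v \<bullet> v)) + 4 / t ^ 4 * flat 2 (a y) * ((y - x) \<bullet> v)\<^sup>2" for v
  proof -
    have "((\<lambda>z. (z - x) \<bullet> v) has_derivative (\<lambda>w. w \<bullet> v)) (at y)"
      by (auto intro!: derivative_eq_intros)
    from has_derivative_mult_right[OF has_derivative_mult[OF fl[of 1 y] this], of "- 2 / t\<^sup>2"]
    have "frechet_derivative (\<lambda>z. (- 2 / t\<^sup>2) * (flat 1 (a z) * ((z - x) \<bullet> v))) (at y) v
      = (- 2 / t\<^sup>2) * (flat 1 (a y) * (v \<bullet> v) + flat (Suc 1) (a y) * ((- 2 / t\<^sup>2) * ((y - x) \<bullet> v)) * ((y - x) \<bullet> v))"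
      by (rule fun_cong[OF frechet_derivative_at[symmetric]])
    also have "\<dots> = (- 2 / t\<^sup>2) * (flat 1 (a y) * (v \<bullet> v)) + 4 / t ^ 4 * flat 2 (a y) * ((y - x) \<bullet> v)\<^sup>2"
    proof -
      have "t ^ 4 = t\<^sup>2 * t\<^sup>2" by (simp add: power_add[symmetric])
      then show ?thesis by (simp add: power2_eq_square numeral_2_eq_2 distrib_left diff_divide_distrib)
    qed
    finally show ?thesis by (simp only: first)
  qed
  have sq: "(y - x) \<bullet> (y - x) = (\<Sum>i\<in>UNIV. ((y - x) $ i)\<^sup>2)"
    by (simp add: inner_vec_def power2_eq_square)
  define \<alpha> \<beta> where "\<alpha> = (- 2 / t\<^sup>2) * flat 1 (a y)" and "\<beta> = 4 / t ^ 4 * flat 2 (a y)"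
  have s: "frechet_derivative (\<lambda>z. frechet_derivative (radial_bump x t) (at z) (axis i 1)) (at y) (axis i 1)
     = \<alpha> + \<beta> * ((y - x) $ i)\<^sup>2" for i
    unfolding second by (simp add: inner_axis \<alpha>_def \<beta>_def)
  have "laplacian (radial_bump x t) y = real CARD('n) * \<alpha> + \<beta> * ((y - x) \<bullet> (y - x))"
    unfolding laplacian_def s sum.distrib sum_distrib_left[symmetric] sq by simp
  then show ?thesis by (simp add: \<alpha>_def \<beta>_def a_def mult.commute mult.left_commute)
qed

lemma DERIV_radial_kernel:
  fixes x :: "real^'n"
  assumes t: "t > 0"
  shows "((\<lambda>t. radial_kernel x t y) has_real_derivative (t / t ^ CARD('n) * laplacian (radial_bump x t) y)) (at t)"
proof -
  define d where "d = (y - x) \<bullet> (y - x)"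
  obtain m where m: "CARD('n) = Suc m" using not0_implies_Suc[of "CARD('n)"] by auto
  have d1: "((\<lambda>t. 1 - d / t\<^sup>2) has_real_derivative (2 * d / t ^ 3)) (at t)"
    using t by (auto intro!: derivative_eq_intros simp: field_simps power2_eq_square power3_eq_cube)
  have "((\<lambda>t. 2 * flat 1 (1 - d / t\<^sup>2) / t ^ Suc m) has_real_derivative
     ((2 * (flat (Suc 1) (1 - d / t\<^sup>2) * (2 * d / t ^ 3))) * t ^ Suc m
       - 2 * flat 1 (1 - d / t\<^sup>2) * (real (Suc m) * t ^ m)) / (t ^ Suc m * t ^ Suc m)) (at t)"
    using t by (intro DERIV_divide DERIV_cmult DERIV_chain2[OF flat_has_real_derivative d1])
      (use DERIV_pow[of "Suc m" t] in auto)
  also have "((2 * (flat (Suc 1) (1 - d / t\<^sup>2) * (2 * d / t ^ 3))) * t ^ Suc m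
       - 2 * flat 1 (1 - d / t\<^sup>2) * (real (Suc m) * t ^ m)) / (t ^ Suc m * t ^ Suc m)
    = t / t ^ Suc m * (4 * d / t ^ 4 * flat 2 (1 - d / t\<^sup>2) - 2 * real (Suc m) / t\<^sup>2 * flat 1 (1 - d / t\<^sup>2))"
    using t by (simp add: field_simps power2_eq_square power3_eq_cube power4_eq_xxxx numeral_2_eq_2[symmetric])
  finally show ?thesis
    unfolding radial_kernel_def laplacian_radial_bump d_def m .
qed

lemma measure_lebesgue_ball:
  fixes x :: "real^'n"
  shows "r \<ge> 0 \<Longrightarrow> measure lebesgue (ball x r) = unit_ball_vol (real CARD('n)) * r ^ CARD('n)"
  by (simp add: content_ball)

lemma continuous_on_radial_kernel: "continuous_on S (radial_kernel x t)"
  unfolding radial_kernel_def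
  by (cases "t = 0")
     (auto intro!: continuous_intros continuous_on_compose2[OF continuous_on_flat[of UNIV]])

text \<open>Let \<open>M t\<close> be the integral of \<open>u\<close> against the kernel of radius \<open>t\<close>.  Its derivative is
\<open>t / t ^ n\<close> times \<open>\<integral> u * \<Delta> (radial_bump x t)\<close>, hence at most \<open>K * \<omega> * t\<close>, where \<open>\<omega>\<close> is the volume of
the unit ball.  As \<open>t\<close> tends to \<open>0\<close>, \<open>M t\<close> is asymptotically at most \<open>4 * \<omega> * u x\<close> by continuity, and
\<open>M R\<close> controls the integral of \<open>u\<close> over the half ball since the kernel is bounded below there.\<close>

lemma supersolution_ball_integral_le:
  fixes u :: "real^'n \<Rightarrow> real"
  assumes cont: "continuous_on UNIV u" and R: "R > 0" and K: "K \<ge> 0"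
    and nonneg: "\<And>y. y \<in> ball x R \<Longrightarrow> 0 \<le> u y"
    and super: "\<And>t. 0 < t \<Longrightarrow> t \<le> R \<Longrightarrow>
      (LINT y|lebesgue. u y * laplacian (radial_bump x t) y) \<le> K * (LINT y|lebesgue. radial_bump x t y)"
  shows "(LINT y|lebesgue. indicator (cball x (R / 2)) y * u y)
    \<le> exp 2 / 2 * R ^ CARD('n) * (unit_ball_vol (real CARD('n)) * (4 * u x + K * R\<^sup>2 / 2))"
proof -
  define \<omega> where "\<omega> = unit_ball_vol (real CARD('n))"
  let ?n = "CARD('n)"
  have \<omega>: "\<omega> > 0" by (simp add: \<omega>_def)
  obtain c :: "real^'n" where c: "cball x R \<subseteq> cbox (- c) c"
    using bounded_subset_cbox_symmetric[OF bounded_cball] by blast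
  define M where "M t = integral (cbox (- c) c) (\<lambda>y. u y * radial_kernel x t y)" for t
  define M' where "M' t = integral (cbox (- c) c) (\<lambda>y. u y * (t / t ^ ?n * laplacian (radial_bump x t) y))" for t
  have M_eq: "M t = (LINT y|lebesgue. u y * radial_kernel x t y)" if "0 < t" "t \<le> R" for t
    unfolding M_def
  proof (rule lebesgue_integral_eq_cbox_integral[symmetric])
    show "continuous_on UNIV (\<lambda>y. u y * radial_kernel x t y)"
      by (intro continuous_intros cont continuous_on_radial_kernel)
    show "u y * radial_kernel x t y = 0" if "y \<notin> cbox (- c) c" for y
    proof -
      have "y \<notin> cball x R" using that c by blast
      then have "y \<notin> ball x t" using \<open>t \<le> R\<close> by auto
      then show ?thesis using \<open>0 < t\<close> by (simp add: radial_kernel_eq_0)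
    qed
  qed
  have int_kernel: "integrable lebesgue (\<lambda>y. u y * radial_kernel x t y)" if "0 < t" for t
  proof (rule integrable_continuous_bounded_support)
    show "continuous_on UNIV (\<lambda>y. u y * radial_kernel x t y)"
      by (intro continuous_intros cont continuous_on_radial_kernel)
    have "{y. u y * radial_kernel x t y \<noteq> 0} \<subseteq> ball x t"
      using radial_kernel_eq_0[OF that, of _ x] by force
    then show "bounded {y. u y * radial_kernel x t y \<noteq> 0}"
      by (rule bounded_subset[OF bounded_ball])
  qed
  have DM: "(M has_real_derivative M' t) (at t)" if t: "t > 0" for t
  proof -
    have "((\<lambda>t. integral (cbox (- c) c) (\<lambda>y. u y * radial_kernel x t y)) has_field_derivative
       integral (cbox (- c) c) (\<lambda>y. u y * (t / t ^ ?n * laplacian (radial_bump x t) y))) (at t within {0<..})"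
    proof (rule leibniz_rule_field_derivative)
      show "((\<lambda>t. u y * radial_kernel x t y) has_field_derivative
          u y * (t / t ^ ?n * laplacian (radial_bump x t) y)) (at t within {0<..})"
        if "t \<in> {0<..}" for t y
        by (rule has_field_derivative_at_within[OF DERIV_cmult[OF DERIV_radial_kernel]]) (use that in simp)
      show "(\<lambda>y. u y * radial_kernel x t y) integrable_on cbox (- c) c" if "t \<in> {0<..}" for t
        by (intro integrable_continuous continuous_intros continuous_on_radial_kernel
            continuous_on_subset[OF cont]) auto
      show "continuous_on ({0<..} \<times> cbox (- c) c)
          (\<lambda>(t, y). u y * (t / t ^ ?n * laplacian (radial_bump x t) y))"
        unfolding laplacian_radial_bump split_def
        by (intro continuous_intros continuous_on_compose2[OF cont] continuous_on_compose2[OF continuous_on_flat[of UNIV]])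
           auto
    qed (use t in auto)
    then show ?thesis
      using t by (simp add: M_def[abs_def] M'_def at_within_open[of t "{0<..}"])
  qed
  have M'_le: "M' t \<le> K * \<omega> * t" if t: "0 < t" "t \<le> R" for t
  proof -
    note tf = test_function_radial_bump[OF t(1), of x]
    have "M' t = (t / t ^ ?n) * integral (cbox (- c) c) (\<lambda>y. u y * laplacian (radial_bump x t) y)"
      unfolding M'_def by (simp add: mult.left_commute flip: integral_mult_right)
    also have "integral (cbox (- c) c) (\<lambda>y. u y * laplacian (radial_bump x t) y)
       = (LINT y|lebesgue. u y * laplacian (radial_bump x t) y)"
    proof (rule lebesgue_integral_eq_cbox_integral[symmetric])
      show "continuous_on UNIV (\<lambda>y. u y * laplacian (radial_bump x t) y)"
        unfolding laplacian_radial_bump using t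
        by (intro continuous_intros cont continuous_on_compose2[OF continuous_on_flat[of UNIV]]) auto
      show "u y * laplacian (radial_bump x t) y = 0" if "y \<notin> cbox (- c) c" for y
      proof -
        have "y \<notin> cball x R" using that c by blast
      then have "y \<notin> ball x t" using \<open>t \<le> R\<close> by auto
        then have "flat j (1 - ((y - x) \<bullet> (y - x)) / t\<^sup>2) = 0" for j
          using t by (intro flat_nonpos radial_arg_nonpos)
        then show ?thesis by (simp only: laplacian_radial_bump) simp
      qed
    qed
    also have "(t / t ^ ?n) * (LINT y|lebesgue. u y * laplacian (radial_bump x t) y)
        \<le> (t / t ^ ?n) * (K * (\<omega> * t ^ ?n))"
    proof (intro mult_left_mono order_trans[OF super[OF t]])
      have "(LINT y|lebesgue. radial_bump x t y) \<le> (LINT y|lebesgue. indicator (ball x t) y)"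
      proof (rule integral_mono)
        show "integrable lebesgue (radial_bump x t)"
          by (rule integrable_continuous_bounded_support[OF test_functionD(3,2)[OF tf]])
        show "integrable lebesgue (indicator (ball x t) :: real^'n \<Rightarrow> real)"
          using lmeasurable_ball[of x t] by (simp add: fmeasurable_def)
        show "radial_bump x t y \<le> indicator (ball x t) y" for y
          using radial_bump_bounds[of x t y] radial_bump_eq_0[OF t(1), of y x]
          by (cases "y \<in> ball x t") auto
      qed
      also have "\<dots> = \<omega> * t ^ ?n"
        using t by (simp add: \<omega>_def content_ball)
      finally show "(LINT y|lebesgue. radial_bump x t y) \<le> \<omega> * t ^ ?n" .
    qed (use t K in auto)
    also have "\<dots> = K * \<omega> * t" using t by simp
    finally show ?thesis .
  qed
  have mono: "M R \<le> M t + K * \<omega> * R\<^sup>2 / 2" if t: "0 < t" "t \<le> R" for t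
  proof -
    have "M R - K * \<omega> * R\<^sup>2 / 2 \<le> M t - K * \<omega> * t\<^sup>2 / 2"
    proof (rule DERIV_nonpos_imp_nonincreasing[OF t(2), where f = "\<lambda>t. M t - K * \<omega> * t\<^sup>2 / 2"])
      fix r assume r: "t \<le> r" "r \<le> R"
      have "((\<lambda>t. M t - K * \<omega> * t\<^sup>2 / 2) has_real_derivative M' r - K * \<omega> * r) (at r)"
        using r t by (auto intro!: derivative_eq_intros DM)
      then show "\<exists>y. ((\<lambda>t. M t - K * \<omega> * t\<^sup>2 / 2) has_real_derivative y) (at r) \<and> y \<le> 0"
        using M'_le[of r] r t by (intro exI[of _ "M' r - K * \<omega> * r"]) auto
    qed
    moreover have "0 \<le> K * \<omega> * t\<^sup>2 / 2" using K \<omega> by simp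
    ultimately show ?thesis by linarith
  qed
  have upper: "M R \<le> 4 * \<omega> * u x + K * \<omega> * R\<^sup>2 / 2"
  proof (rule field_le_epsilon)
    fix e :: real assume e: "e > 0"
    define b where "b = u x + e / (4 * \<omega>)"
    have "\<forall>\<^sub>F y in at x. u y < b"
      using cont \<omega> e by (intro order_tendstoD(2)[of _ "u x"])
        (auto simp: b_def continuous_on_eq_continuous_at isCont_def)
    then obtain r where r: "r > 0" "\<And>y. y \<noteq> x \<Longrightarrow> dist y x < r \<Longrightarrow> u y < b"
      unfolding eventually_at by auto
    define t where "t = min r R"
    have t: "0 < t" "t \<le> R" using r R by (auto simp: t_def)
    have ub: "u y \<le> b" if "y \<in> ball x t" for y
      using that r(2)[of y] \<omega> e by (cases "y = x") (auto simp: t_def b_def dist_commute)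
    have "M t \<le> (LINT y|lebesgue. indicator (ball x t) y * (b * (4 / t ^ ?n)))"
      unfolding M_eq[OF t]
    proof (rule integral_mono[OF int_kernel[OF t(1)]])
      show "integrable lebesgue (\<lambda>y. indicator (ball x t) y * (b * (4 / t ^ ?n)))"
        using lmeasurable_ball[of x t] by (simp add: fmeasurable_def)
      show "u y * radial_kernel x t y \<le> indicator (ball x t) y * (b * (4 / t ^ ?n))" for y
      proof (cases "y \<in> ball x t")
        case True
        then have uy: "0 \<le> u y" "u y \<le> b" using nonneg[of y] ub[of y] t by auto
        moreover have "0 \<le> radial_kernel x t y" "radial_kernel x t y \<le> 4 / t ^ ?n"
          using t flat_1_bounds by (auto simp: radial_kernel_def intro!: divide_right_mono)
        ultimately show ?thesis using True by (simp add: mult_mono del: times_divide_eq_right)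
      qed (simp add: radial_kernel_eq_0 t)
    qed
    also have "\<dots> = measure lebesgue (ball x t) * (b * (4 / t ^ ?n))" by simp
    also have "\<dots> = 4 * \<omega> * b"
      unfolding measure_lebesgue_ball[OF less_imp_le[OF t(1)]] using t by (simp add: \<omega>_def)
    also have "\<dots> = 4 * \<omega> * u x + e" using \<omega> by (simp add: b_def field_simps)
    finally show "M R \<le> 4 * \<omega> * u x + K * \<omega> * R\<^sup>2 / 2 + e"
      using mono[OF t] by linarith
  qed
  have "(LINT y|lebesgue. indicator (cball x (R / 2)) y * (u y * (2 * exp (- 2) / R ^ ?n))) \<le> M R"
    unfolding M_eq[OF R order_refl]
  proof (rule integral_mono[OF _ int_kernel[OF R]])
    show "integrable lebesgue (\<lambda>y. indicator (cball x (R / 2)) y * (u y * (2 * exp (- 2) / R ^ ?n)))"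
      using R by (intro integrable_continuous_on_cball continuous_intros cont) auto
    show "indicator (cball x (R / 2)) y * (u y * (2 * exp (- 2) / R ^ ?n)) \<le> u y * radial_kernel x R y" for y
    proof (cases "y \<in> cball x (R / 2)")
      case True
      define a where "a = 1 - ((y - x) \<bullet> (y - x)) / R\<^sup>2"
      have "(dist x y)\<^sup>2 \<le> (R / 2)\<^sup>2" using True by (intro power_mono) auto
      then have a: "3 / 4 \<le> a" "a \<le> 1"
        using R by (auto simp: a_def inner_self_diff_eq_dist power_divide field_simps)
      then have "exp (- 2) \<le> exp (- 1 / a)" "1 \<le> (1 / a)\<^sup>2"
        by (auto simp: field_simps power_le_one)
      then have "1 * exp (- 2) \<le> (1 / a)\<^sup>2 * exp (- 1 / a)" by (intro mult_mono) auto
      then have "exp (- 2) \<le> flat 1 a" using a flat_1[of a] by auto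
      then have "2 * exp (- 2) / R ^ ?n \<le> radial_kernel x R y"
        using R by (simp add: radial_kernel_def a_def divide_right_mono)
      moreover have "0 \<le> u y" using nonneg[of y] True R by auto
      ultimately show ?thesis using True by (simp add: mult_left_mono del: times_divide_eq_right)
    next
      case False
      have "0 \<le> u y * radial_kernel x R y"
      proof (cases "y \<in> ball x R")
        case True
        then show ?thesis using nonneg[of y] flat_1_bounds R
          by (intro mult_nonneg_nonneg) (auto simp: radial_kernel_def)
      qed (simp add: radial_kernel_eq_0 R)
      then show ?thesis using False by simp
    qed
  qed
  also note upper
  also have "(LINT y|lebesgue. indicator (cball x (R / 2)) y * (u y * (2 * exp (- 2) / R ^ ?n)))
    = (LINT y|lebesgue. indicator (cball x (R / 2)) y * u y) * (2 * exp (- 2) / R ^ ?n)"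
    by (simp only: mult.assoc[symmetric] integral_mult_left_zero)
  finally have "(LINT y|lebesgue. indicator (cball x (R / 2)) y * u y) * (2 * exp (- 2) / R ^ ?n)
    \<le> 4 * \<omega> * u x + K * \<omega> * R\<^sup>2 / 2" .
  then show ?thesis
    using R unfolding \<omega>_def[symmetric] by (simp add: exp_minus field_simps)
qed

section \<open>Nondegeneracy\<close>

text \<open>On a null set \<open>\<Omega>\<close>, where the essential supremum is \<open>-\<infinity>\<close>, the claim is vacuous.  The absolute value on
the right makes the bound visibly nonnegative.\<close>

lemma AE_le_Linf_norm:
  assumes "ess_bounded \<Omega> h"
  shows "AE y in lebesgue_on \<Omega>. \<bar>h y\<bar> \<le> \<bar>Linf_norm \<Omega> h\<bar>"
proof -
  have "AE y in lebesgue_on \<Omega>. ereal \<bar>h y\<bar> \<le> esssup (lebesgue_on \<Omega>) (\<lambda>y. ereal \<bar>h y\<bar>)"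
    by (rule esssup_AE)
  then show ?thesis
  proof eventually_elim
    case (elim y)
    then show ?case
      using assms unfolding ess_bounded_def Linf_norm_def
      by (cases "esssup (lebesgue_on \<Omega>) (\<lambda>y. ereal \<bar>h y\<bar>)") auto
  qed
qed

text \<open>Both competitors combined at one scale: removing the ball bounds \<open>lam * \<omega> * s ^ n\<close> by a multiple
of \<open>(1 / s) * \<integral> u\<close> over \<open>cball x (2 * s)\<close>, and the mean value inequality with radius \<open>4 * s\<close> bounds
this integral.  The factor \<open>\<omega> * s ^ n\<close> cancels.\<close>

lemma minimizer_nondegeneracy_at_scale:
  fixes u :: "nat \<Rightarrow> real^'n \<Rightarrow> real"
  defines "\<omega> \<equiv> unit_ball_vol (real CARD('n))"
  assumes N: "N \<ge> 1" and \<Omega>: "\<Omega> \<in> sets borel"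
    and conv: "J_integrals_converge N \<Omega> f g" and min: "is_minimizer N \<Omega> f g F u W"
    and cont: "continuous_on UNIV (u 1)"
    and f: "AE y in lebesgue_on \<Omega>. \<bar>f 1 y\<bar> \<le> Mf" and g: "AE y in lebesgue_on \<Omega>. \<bar>g 1 y\<bar> \<le> Mg"
    and nonneg: "0 \<le> Mf" "0 \<le> Mg" "0 \<le> C"
    and nondeg: "nondegenerate N F W lam \<epsilon>"
    and s: "0 < s" "s \<le> 1" "\<omega> * s ^ CARD('n) \<le> \<epsilon>"
    and pos: "\<And>y. y \<in> ball x (4 * s) \<Longrightarrow> y \<in> \<Omega> \<and> 0 < u 1 y \<and> u 1 y \<le> C * s"
  shows "lam \<le> 2 * exp 2 * 4 ^ CARD('n) * (8 * cutoff_lip\<^sup>2 * C + Mf * C + Mg)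
    * (u 1 x / s + 2 * (Mf * C + Mg / 2) * s)"
proof -
  let ?n = "CARD('n)"
  define K where "K = Mf * C + Mg / 2"
  define C3 where "C3 = 8 * cutoff_lip\<^sup>2 * C + Mf * C + Mg"
  define I where "I = (LINT y|lebesgue. indicator (cball x (2 * s)) y * u 1 y)"
  have \<omega>: "\<omega> > 0" by (simp add: \<omega>_def)
  have K0: "0 \<le> K" and C30: "0 \<le> C3" using nonneg by (simp_all add: K_def C3_def)
  have mball: "measure lebesgue (ball x s) = \<omega> * s ^ ?n"
    using s by (simp add: \<omega>_def content_ball)
  have sub: "cball x (2 * s) \<subseteq> ball x (4 * s)" using s by auto
  have pos2: "y \<in> \<Omega> \<and> 0 < u 1 y \<and> u 1 y \<le> C * s" if "y \<in> cball x (2 * s)" for y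
    using pos[of y] sub that by blast
  have "lam * (\<omega> * s ^ ?n)
    \<le> (LINT y|lebesgue. indicator (cball x (2 * s)) y * (8 * (u 1 y)\<^sup>2 * (cutoff_lip / s)\<^sup>2))
     + (LINT y|lebesgue. indicator (cball x (2 * s)) y * (Mf * (u 1 y)\<^sup>2 + Mg * u 1 y))"
    unfolding mball[symmetric]
    by (rule removing_ball_energy_bound[OF N \<Omega> conv min cont f g nondeg])
       (use s pos2 in \<open>auto simp: mball\<close>)
  also have "\<dots> = (LINT y|lebesgue. indicator (cball x (2 * s)) y * (8 * (u 1 y)\<^sup>2 * (cutoff_lip / s)\<^sup>2)
      + indicator (cball x (2 * s)) y * (Mf * (u 1 y)\<^sup>2 + Mg * u 1 y))"
    by (intro Bochner_Integration.integral_add[symmetric] integrable_continuous_on_cball continuous_intros cont)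
  also have "\<dots> \<le> (LINT y|lebesgue. (C3 / s) * (indicator (cball x (2 * s)) y * u 1 y))"
  proof (rule integral_mono)
    show "integrable lebesgue (\<lambda>y. indicator (cball x (2 * s)) y * (8 * (u 1 y)\<^sup>2 * (cutoff_lip / s)\<^sup>2)
      + indicator (cball x (2 * s)) y * (Mf * (u 1 y)\<^sup>2 + Mg * u 1 y))"
      by (intro Bochner_Integration.integrable_add integrable_continuous_on_cball continuous_intros cont)
    show "integrable lebesgue (\<lambda>y. (C3 / s) * (indicator (cball x (2 * s)) y * u 1 y))"
      by (intro integrable_mult_right integrable_continuous_on_cball cont)
    fix y
    show "indicator (cball x (2 * s)) y * (8 * (u 1 y)\<^sup>2 * (cutoff_lip / s)\<^sup>2)
      + indicator (cball x (2 * s)) y * (Mf * (u 1 y)\<^sup>2 + Mg * u 1 y)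
      \<le> (C3 / s) * (indicator (cball x (2 * s)) y * u 1 y)"
    proof (cases "y \<in> cball x (2 * s)")
      case True
      then have uy: "0 < u 1 y" "u 1 y \<le> C * s" using pos2 by auto
      have "s * s \<le> 1" using s by (simp add: mult_le_one)
      have sq: "(u 1 y)\<^sup>2 \<le> C * s * u 1 y"
        using uy by (simp add: power2_eq_square mult_right_mono)
      have t1: "8 * (u 1 y)\<^sup>2 * (cutoff_lip / s)\<^sup>2 \<le> 8 * (C * s * u 1 y) * (cutoff_lip / s)\<^sup>2"
        by (intro mult_right_mono mult_left_mono sq) auto
      have "8 * (C * s * u 1 y) * (cutoff_lip / s)\<^sup>2 = (8 * cutoff_lip\<^sup>2 * C) / s * u 1 y"
        using s by (simp add: power2_eq_square)
      note t1 = t1[unfolded this]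
      have "Mf * (u 1 y)\<^sup>2 \<le> Mf * (C * s * u 1 y)" by (intro mult_left_mono sq nonneg)
      also have "\<dots> = (Mf * C * u 1 y) * (s * s) / s" using s by simp
      also have "\<dots> \<le> (Mf * C * u 1 y) * 1 / s"
        using s uy nonneg \<open>s * s \<le> 1\<close> by (intro divide_right_mono mult_left_mono) auto
      finally have t2: "Mf * (u 1 y)\<^sup>2 \<le> (Mf * C) / s * u 1 y" by simp
      have "Mg * u 1 y * s \<le> Mg * u 1 y * 1"
        using s uy nonneg by (intro mult_left_mono) auto
      then have t3: "Mg * u 1 y \<le> Mg / s * u 1 y" using s by (simp add: field_simps)
      have "(C3 / s) * u 1 y = (8 * cutoff_lip\<^sup>2 * C) / s * u 1 y + (Mf * C) / s * u 1 y + Mg / s * u 1 y"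
        by (simp add: C3_def add_divide_distrib distrib_right)
      with t1 t2 t3 True show ?thesis by simp
    qed simp
  qed
  also have "\<dots> = (C3 / s) * I" by (simp add: I_def)
  finally have removal: "lam * (\<omega> * s ^ ?n) \<le> (C3 / s) * I" .
  have "(LINT y|lebesgue. indicator (cball x (4 * s / 2)) y * u 1 y)
    \<le> exp 2 / 2 * (4 * s) ^ ?n * (unit_ball_vol (real ?n) * (4 * u 1 x + K * (4 * s)\<^sup>2 / 2))"
  proof (rule supersolution_ball_integral_le[OF cont _ K0])
    show "0 \<le> u 1 y" if "y \<in> ball x (4 * s)" for y using pos[OF that] by simp
    fix t assume t: "0 < t" "t \<le> 4 * s"
    show "(LINT y|lebesgue. u 1 y * laplacian (radial_bump x t) y) \<le> K * (LINT y|lebesgue. radial_bump x t y)"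
    proof (rule minimizer_weak_supersolution[OF N \<Omega> conv min cont f g test_function_radial_bump[OF t(1)]])
      show "0 \<le> radial_bump x t y" for y by (rule radial_bump_bounds)
      show "Mf * C + Mg / 2 \<le> K" by (simp add: K_def)
      fix y assume "radial_bump x t y \<noteq> 0"
      then have "y \<in> ball x t" using radial_bump_eq_0[OF t(1)] by blast
      then have "y \<in> ball x (4 * s)" using t by auto
      moreover have "C * s \<le> C * 1" using s nonneg by (intro mult_left_mono) auto
      ultimately show "y \<in> \<Omega> \<and> 0 < u 1 y \<and> u 1 y \<le> C" using pos[of y] by auto
    qed
  qed (use s in auto)
  then have "I \<le> exp 2 / 2 * (4 * s) ^ ?n * (\<omega> * (4 * u 1 x + K * (4 * s)\<^sup>2 / 2))"
    by (simp add: I_def \<omega>_def)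
  also have "\<dots> = (2 * exp 2 * 4 ^ ?n * (u 1 x + 2 * K * s\<^sup>2)) * (\<omega> * s ^ ?n)"
    by (simp add: power_mult_distrib power2_eq_square algebra_simps)
  finally have "(C3 / s) * I \<le> (C3 / s) * ((2 * exp 2 * 4 ^ ?n * (u 1 x + 2 * K * s\<^sup>2)) * (\<omega> * s ^ ?n))"
    using C30 s by (intro mult_left_mono) auto
  with removal have "lam * (\<omega> * s ^ ?n)
    \<le> ((C3 / s) * (2 * exp 2 * 4 ^ ?n * (u 1 x + 2 * K * s\<^sup>2))) * (\<omega> * s ^ ?n)"
    by (simp only: mult.assoc)
  then have "lam \<le> (C3 / s) * (2 * exp 2 * 4 ^ ?n * (u 1 x + 2 * K * s\<^sup>2))"
    using \<omega> s by (simp only: mult_le_cancel_right_pos mult_pos_pos zero_less_power)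
  also have "\<dots> = 2 * exp 2 * 4 ^ ?n * C3 * (u 1 x / s + 2 * K * s)"
    using s by (simp add: power2_eq_square field_simps)
  finally show ?thesis by (simp only: C3_def K_def)
qed

theorem theorem15p3:
  fixes lam Mf Mg C0 :: real
  assumes "CARD('n::finite) \<ge> 2" and "lam > 0" and "C0 \<ge> 1"
  shows "\<exists>c5>0. \<forall>(N::nat) (\<Omega> :: (real^'n) set) f g F u W \<epsilon>.
     N \<ge> 1 \<longrightarrow>
     \<Omega> \<in> sets borel \<longrightarrow> emeasure lebesgue \<Omega> < \<infinity> \<longrightarrow>
     (\<forall>i\<in>{1..N}. f i \<in> borel_measurable (lebesgue_on \<Omega>) \<and> g i \<in> borel_measurable (lebesgue_on \<Omega>)) \<longrightarrow>
     J_integrals_converge N \<Omega> f g \<longrightarrow>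
     is_minimizer N \<Omega> f g F u W \<longrightarrow>
     continuous_on UNIV (u 1) \<longrightarrow>
     ess_bounded \<Omega> (f 1) \<longrightarrow> ess_bounded \<Omega> (g 1) \<longrightarrow>
     Linf_norm \<Omega> (f 1) = Mf \<longrightarrow> Linf_norm \<Omega> (g 1) = Mg \<longrightarrow>
     \<epsilon> > 0 \<longrightarrow> nondegenerate N F W lam \<epsilon> \<longrightarrow>
     (let \<Omega>\<^sub>1 = positive_region \<Omega> (u 1); \<delta> = (\<lambda>x. infdist x (- \<Omega>\<^sub>1)) in
        \<forall>x\<in>\<Omega>\<^sub>1. C0-lipschitz_on (ball x (\<delta> x / 2)) (u 1) \<longrightarrow>
          u 1 x \<ge> c5 * min (\<delta> x) (min (\<epsilon> powr (1 / real CARD('n))) 1))"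
proof -
  define n where "n = CARD('n)"
  define \<omega> where "\<omega> = unit_ball_vol (real n)"
  define C where "C = 1 + 4 * C0"
  define K where "K = \<bar>Mf\<bar> * C + \<bar>Mg\<bar> / 2"
  define C4 where "C4 = 2 * exp 2 * 4 ^ n * (8 * cutoff_lip\<^sup>2 * C + \<bar>Mf\<bar> * C + \<bar>Mg\<bar>)"
  \<comment> \<open>The three bounds keep \<open>ball x (4 * s)\<close> inside \<open>ball x (\<delta> x / 2)\<close>, the volume of \<open>ball x s\<close>
  below \<open>\<epsilon>\<close>, and the error term \<open>C4 * 2 * K * s\<close> below \<open>lam / 2\<close>.\<close>
  define \<kappa> where "\<kappa> = min (1 / 8) (min (1 / (1 + \<omega>)) (lam / (4 * C4 * (K + 1))))"
  define c5 where "c5 = \<kappa> * min 1 (lam / (2 * C4))"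
  have n: "n \<ge> 1" by (simp add: n_def Suc_leI)
  have \<omega>: "\<omega> > 0" by (simp add: \<omega>_def)
  have C: "C \<ge> 1" using assms by (simp add: C_def)
  have K: "K \<ge> 0" using C by (simp add: K_def)
  have "cutoff_lip > 0" by (simp add: cutoff_lip_def flat_0_pos)
  then have C4: "C4 > 0"
    using C unfolding C4_def by (intro mult_pos_pos add_pos_nonneg) auto
  have \<kappa>: "0 < \<kappa>" "\<kappa> \<le> 1 / 8" "\<kappa> \<le> 1 / (1 + \<omega>)" "\<kappa> \<le> lam / (4 * C4 * (K + 1))"
  proof -
    show "0 < \<kappa>" using \<omega> K C4 assms by (simp add: \<kappa>_def)
  qed (unfold \<kappa>_def, linarith+)
  have \<kappa>\<omega>: "\<omega> * \<kappa> ^ n \<le> 1"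
  proof -
    have "\<kappa> ^ n \<le> \<kappa> ^ 1" using \<kappa> n by (intro power_decreasing) auto
    also have "\<dots> \<le> 1 / (1 + \<omega>)" using \<kappa> by simp
    finally have "\<omega> * \<kappa> ^ n \<le> \<omega> * (1 / (1 + \<omega>))" using \<omega> by (intro mult_left_mono) auto
    also have "\<dots> \<le> 1" using \<omega> by simp
    finally show ?thesis .
  qed
  have \<kappa>K: "C4 * (2 * K * \<kappa>) \<le> lam / 2"
  proof -
    have "C4 * (2 * K * \<kappa>) \<le> C4 * (2 * (K + 1) * (lam / (4 * C4 * (K + 1))))"
      using C4 K \<kappa> by (intro mult_left_mono mult_mono) auto
    also have "\<dots> = lam / 2"
    proof -
      have "c * (2 * k * (l / (4 * c * k))) = l / 2" if "c > 0" "k > 0" for c k l :: real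
        using that by (simp add: field_simps)
      from this[OF C4, of "K + 1"] show ?thesis using K by simp
    qed
    finally show ?thesis .
  qed
  show ?thesis
  proof (intro exI[of _ c5] conjI allI impI)
    show "c5 > 0" using \<kappa> C4 assms by (simp add: c5_def)
  next
    fix N :: nat and \<Omega> :: "(real^'n) set" and f g :: "nat \<Rightarrow> real^'n \<Rightarrow> real" and F u W \<epsilon>
    assume N: "N \<ge> 1" and \<Omega>: "\<Omega> \<in> sets borel"
      and conv: "J_integrals_converge N \<Omega> f g" and min: "is_minimizer N \<Omega> f g F u W"
      and cont: "continuous_on UNIV (u 1)"
      and bdd: "ess_bounded \<Omega> (f 1)" "ess_bounded \<Omega> (g 1)"
      and norms: "Linf_norm \<Omega> (f 1) = Mf" "Linf_norm \<Omega> (g 1) = Mg"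
      and \<epsilon>: "\<epsilon> > 0" and nondeg: "nondegenerate N F W lam \<epsilon>"
    define \<Omega>1 where "\<Omega>1 = positive_region \<Omega> (u 1)"
    define \<delta> where "\<delta> x = infdist x (- \<Omega>1)" for x
    have "u 1 x \<ge> c5 * min (\<delta> x) (min (\<epsilon> powr (1 / real n)) 1)"
      if x: "x \<in> \<Omega>1" and lip: "C0-lipschitz_on (ball x (\<delta> x / 2)) (u 1)" for x
    proof -
      define r where "r = min (\<delta> x) (min (\<epsilon> powr (1 / real n)) 1)"
      define s where "s = \<kappa> * r"
      have ux: "u 1 x > 0" using x by (simp add: \<Omega>1_def positive_region_def)
      have "\<delta> x \<ge> 0" by (simp add: \<delta>_def infdist_nonneg)
      then have "r \<ge> 0" by (simp add: r_def)
      have c5_le: "c5 * r \<le> s" "c5 * r \<le> lam / (2 * C4) * s"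
      proof -
        have "(\<kappa> * r) * min 1 (lam / (2 * C4)) \<le> (\<kappa> * r) * 1"
          "(\<kappa> * r) * min 1 (lam / (2 * C4)) \<le> (\<kappa> * r) * (lam / (2 * C4))"
          using \<kappa> \<open>r \<ge> 0\<close> by (intro mult_left_mono; simp)+
        then show "c5 * r \<le> s" "c5 * r \<le> lam / (2 * C4) * s"
          by (simp_all add: c5_def s_def mult_ac)
      qed
      have "c5 * r \<le> u 1 x"
      proof (cases "r = 0 \<or> s \<le> u 1 x")
        case True
        then show ?thesis using c5_le ux by auto
      next
        case False
        then have r: "r > 0" and us: "u 1 x < s" using \<open>r \<ge> 0\<close> by auto
        then have s: "s > 0" using \<kappa> by (simp add: s_def)
        have r_le: "r \<le> \<delta> x" "r \<le> \<epsilon> powr (1 / real n)" "r \<le> 1" by (simp_all add: r_def)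
        have s_le: "8 * s \<le> r"
          using mult_right_mono[OF \<kappa>(2) \<open>r \<ge> 0\<close>] by (simp add: s_def)
        have "s \<le> \<kappa> * 1" unfolding s_def using \<kappa> r_le by (intro mult_left_mono) auto
        then have s\<kappa>: "s \<le> \<kappa>" by simp
        have ball_sub: "y \<in> \<Omega>1" if "y \<in> ball x (4 * s)" for y
        proof (rule ccontr)
          assume "y \<notin> \<Omega>1"
          then have "\<delta> x \<le> dist x y" unfolding \<delta>_def by (intro infdist_le) auto
          then show False using that s_le r_le s by auto
        qed
        have pos: "y \<in> \<Omega> \<and> 0 < u 1 y \<and> u 1 y \<le> C * s" if y: "y \<in> ball x (4 * s)" for y
        proof -
          have "dist (u 1 y) (u 1 x) \<le> C0 * dist y x"
            using y s s_le r_le by (intro lipschitz_onD[OF lip]) auto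
          also have "\<dots> \<le> C0 * (4 * s)"
            using y assms by (intro mult_left_mono) (auto simp: dist_commute)
          finally have "u 1 y \<le> u 1 x + C0 * (4 * s)" by (simp add: dist_real_def)
          then have "u 1 y \<le> C * s" using us by (simp add: C_def algebra_simps)
          then show ?thesis using ball_sub[OF y] by (simp add: \<Omega>1_def positive_region_def)
        qed
        have "\<omega> * s ^ n \<le> \<epsilon>"
        proof -
          have "\<omega> * s ^ n = (\<omega> * \<kappa> ^ n) * r ^ n" by (simp add: s_def power_mult_distrib)
          also have "\<dots> \<le> 1 * (\<epsilon> powr (1 / real n)) ^ n"
            using \<kappa>\<omega> r_le r by (intro mult_mono power_mono) auto
          also have "\<dots> = \<epsilon>" using n \<epsilon> by (simp add: powr_powr flip: powr_realpow)
          finally show ?thesis .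
        qed
        then have "lam \<le> C4 * (u 1 x / s + 2 * K * s)"
          unfolding C4_def K_def n_def \<omega>_def
          using AE_le_Linf_norm[OF bdd(1)] AE_le_Linf_norm[OF bdd(2)] C s s\<kappa> \<kappa>(2) norms
          by (intro minimizer_nondegeneracy_at_scale[OF N \<Omega> conv min cont _ _ _ _ _ nondeg _ _ _ pos]) auto
        also have "\<dots> \<le> C4 * (u 1 x / s) + lam / 2"
        proof -
          have "C4 * (2 * K * s) \<le> C4 * (2 * K * \<kappa>)"
            using C4 K s\<kappa> by (intro mult_left_mono) auto
          then show ?thesis using \<kappa>K by (simp add: distrib_left)
        qed
        finally have "lam / 2 \<le> C4 * (u 1 x / s)" by linarith
        then have "lam / (2 * C4) * s \<le> u 1 x" using C4 s by (simp add: field_simps)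
        then show ?thesis using c5_le by simp
      qed
      then show ?thesis by (simp only: r_def)
    qed
    then show "let \<Omega>\<^sub>1 = positive_region \<Omega> (u 1); \<delta> = (\<lambda>x. infdist x (- \<Omega>\<^sub>1)) in
        \<forall>x\<in>\<Omega>\<^sub>1. C0-lipschitz_on (ball x (\<delta> x / 2)) (u 1) \<longrightarrow>
          u 1 x \<ge> c5 * min (\<delta> x) (min (\<epsilon> powr (1 / real CARD('n))) 1)"
      by (simp add: Let_def \<Omega>1_def \<delta>_def n_def)
  qed
qed

end
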